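(* Let $p$ be a Nehari function and let $\phi:\mathbb{D}\to\mathbb{C}^n$ ($n\ge 1$) be holomorphic with $\phi'\neq 0$ on $\mathbb{D}$. If $$|\mathcal{S}\phi(z)|+\frac34\,|\phi'(z)|^2\,|K(\phi(z))|\le 2p(|z|),\qquad z\in\mathbb{D},$$ then $\phi$ is injective in $\mathbb{D}$.
   Context: $\mathbb{D}$ is the open unit disk in $\mathbb{C}$. For a holomorphic curve $\phi=(f_1,\dots,f_n):\mathbb{D}\to\mathbb{C}^n$ with $\phi'=(f_1',\dots,f_n')\ne 0$, put $\sigma=\frac12\log(|f_1'|^2+\cdots+|f_n'|^2)$, so $|\phi'|=e^{\sigma}$ is the Euclidean norm of $\phi'$. The Schwarzian derivative of $\phi$ is $\mathcal{S}\phi=2(\sigma_{zz}-\sigma_z^2)$, where $\sigma_z=\frac12(\sigma_x-i\sigma_y)$. $K(\phi(z))=-e^{-2\sigma(z)}\Delta\sigma(z)\le 0$ denotes the Gaussian curvature at $\phi(z)$ of the surface $\Sigma=\phi(\mathbb{D})\subset\mathbb{C}^n=\mathbb{R}^{2n}$ (with metric induced from the Euclidean metric). A Nehari function is a positive, even, continuous function $p:(-1,1)\to\mathbb{R}$ such that (a) $(1-x^2)^2p(x)$ is non-increasing for $x\in[0,1)$, and (b) the differential equation $u''+pu=0$ has no nontrivial solution with more than one zero in $(-1,1)$. *)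

theory Defs
  imports "HOL-Complex_Analysis.Complex_Analysis"
begin

text \<open>Partial derivatives of a function of the complex variable \<open>z = x + i y\<close>.\<close>

definition partial_x :: "(complex \<Rightarrow> 'a::real_normed_vector) \<Rightarrow> complex \<Rightarrow> 'a" where
  "partial_x f z = vector_derivative (\<lambda>t. f (z + complex_of_real t)) (at 0)"

definition partial_y :: "(complex \<Rightarrow> 'a::real_normed_vector) \<Rightarrow> complex \<Rightarrow> 'a" where
  "partial_y f z = vector_derivative (\<lambda>t. f (z + \<i> * complex_of_real t)) (at 0)"

definition wirtinger :: "(complex \<Rightarrow> complex) \<Rightarrow> complex \<Rightarrow> complex" where
  "wirtinger f z = (partial_x f z - \<i> * partial_y f z) / 2"

definition laplacian :: "(complex \<Rightarrow> real) \<Rightarrow> complex \<Rightarrow> real" where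
  "laplacian f z = partial_x (partial_x f) z + partial_y (partial_y f) z"

definition holomorphic_curve_on :: "(complex \<Rightarrow> complex ^ 'n) \<Rightarrow> complex set \<Rightarrow> bool" where
  "holomorphic_curve_on \<phi> S \<longleftrightarrow> (\<forall>i. (\<lambda>z. \<phi> z $ i) holomorphic_on S)"

definition curve_deriv :: "(complex \<Rightarrow> complex ^ 'n) \<Rightarrow> complex \<Rightarrow> complex ^ 'n" where
  "curve_deriv \<phi> z = (\<chi> i. deriv (\<lambda>w. \<phi> w $ i) z)"

definition log_speed :: "(complex \<Rightarrow> complex ^ 'n) \<Rightarrow> complex \<Rightarrow> real" where
  "log_speed \<phi> z = 1/2 * ln (\<Sum>i\<in>UNIV. (cmod (curve_deriv \<phi> z $ i))\<^sup>2)"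

lemma exp_log_speed:
  assumes "curve_deriv \<phi> z \<noteq> 0"
  shows "exp (log_speed \<phi> z) = norm (curve_deriv \<phi> z)"
proof -
  have "(\<Sum>i\<in>UNIV. (cmod (curve_deriv \<phi> z $ i))\<^sup>2) = (norm (curve_deriv \<phi> z))\<^sup>2"
    by (simp add: norm_vec_def L2_set_def sum_nonneg)
  then show ?thesis
    using assms by (simp add: log_speed_def ln_realpow)
qed

definition schwarzian :: "(complex \<Rightarrow> complex ^ 'n) \<Rightarrow> complex \<Rightarrow> complex" where
  "schwarzian \<phi> z =
     (let \<sigma>\<^sub>z = wirtinger (\<lambda>w. complex_of_real (log_speed \<phi> w))
      in 2 * (wirtinger \<sigma>\<^sub>z z - (\<sigma>\<^sub>z z)\<^sup>2))"

text \<open>The Gaussian curvature at \<open>\<phi>(z)\<close> of the induced metric \<open>e\<^sup>2\<^sup>\<sigma> |dz|\<^sup>2\<close>, as a function of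
  the parameter \<open>z\<close>: the surface may a priori intersect itself.\<close>

definition gauss_curvature :: "(complex \<Rightarrow> complex ^ 'n) \<Rightarrow> complex \<Rightarrow> real" where
  "gauss_curvature \<phi> z = - exp (- 2 * log_speed \<phi> z) * laplacian (log_speed \<phi>) z"

definition ode_solution :: "(real \<Rightarrow> real) \<Rightarrow> (real \<Rightarrow> real) \<Rightarrow> bool" where
  "ode_solution p u \<longleftrightarrow>
     (\<exists>u'. \<forall>x\<in>{-1<..<1}. (u has_real_derivative u' x) (at x) \<and>
                         (u' has_real_derivative - (p x * u x)) (at x))"

text \<open>Only the values of \<open>p\<close> and \<open>u\<close> on \<open>(-1,1)\<close> are relevant.\<close>

definition nehari_function :: "(real \<Rightarrow> real) \<Rightarrow> bool" where
  "nehari_function p \<longleftrightarrow>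
     (\<forall>x\<in>{-1<..<1}. p x > 0) \<and>
     (\<forall>x\<in>{-1<..<1}. p (- x) = p x) \<and>
     continuous_on {-1<..<1} p \<and>
     antimono_on {0..<1} (\<lambda>x. (1 - x\<^sup>2)\<^sup>2 * p x) \<and>
     (\<forall>u. ode_solution p u \<and> (\<exists>x\<in>{-1<..<1}. u x \<noteq> 0) \<longrightarrow>
        \<not> (\<exists>x\<in>{-1<..<1}. \<exists>y\<in>{-1<..<1}. x \<noteq> y \<and> u x = 0 \<and> u y = 0))"

end

theory Submission
  imports Defs
begin

text \<open>
  Suppose \<open>\<phi>\<close> takes the same value at two points of the disk.  They lie on a hyperbolic geodesic
  \<open>T (-1, 1)\<close>, where \<open>T\<close> is an automorphism of the disk, and \<open>\<gamma> = \<phi> \<circ> T\<close> restricted to \<open>(-1, 1)\<close> is a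
  regular curve in a Euclidean space that is not injective.  The contradiction comes from bounding
  the Schwarzian that Ahlfors introduced for such curves,
  \<open>S \<gamma> = <\<gamma>', \<gamma>'''> / |\<gamma>'|\<^sup>2 - 3 <\<gamma>', \<gamma>''>\<^sup>2 / |\<gamma>'|\<^sup>4 + 3/2 |\<gamma>''|\<^sup>2 / |\<gamma>'|\<^sup>2\<close>.

  One-dimensional criterion: if \<open>S \<gamma> \<le> 2 p\<close> for a Nehari function \<open>p\<close>, then \<open>\<gamma>\<close> is injective
  (\<open>inj_on_if_ahlfors_schwarzian_le\<close>).  Were \<open>\<gamma>\<close> to return to a point \<open>q\<close>, the function
  \<open>w = |\<gamma> - q| |\<gamma>'|\<^bsup>-1/2\<^esup>\<close> would be positive between two zeros.  A computation
  (\<open>ahlfors_schwarzian_identity\<close>) shows \<open>w'' / w + S \<gamma> / 2\<close> to be a square, hence \<open>w'' + p w \<ge> 0\<close>, and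
  Sturm comparison with a solution of \<open>y'' + p y = 0\<close> (\<open>sturm_no_positive_bump\<close>) contradicts the
  assumption that no solution has two zeros.

  Schwarzian of the restriction: expressing \<open>\<S>\<phi>\<close> and \<open>K\<close> by Hermitian products of the derivatives of
  \<open>\<phi>\<close>, one finds that Ahlfors' Schwarzian of a holomorphic curve restricted to the real line is
  \<open>Re \<S>\<phi> + 3/4 |\<phi>'|\<^sup>2 |K|\<close> (\<open>ahlfors_schwarzian_eq_vec_schwarzian\<close>).  Under composition with the Moebius
  transformation \<open>T\<close> the two terms are multiplied by \<open>T'\<^sup>2\<close> and \<open>|T'|\<^sup>2\<close>; therefore
  \<open>S \<gamma> (x) \<le> 2 |T' x|\<^sup>2 p |T x|\<close>.

  Nehari's monotonicity: if \<open>T\<close> is normalized so that \<open>T 0\<close> is the point of the geodesic nearest to the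
  origin, then \<open>|T x| \<ge> |x|\<close> and \<open>1 - |T x|\<^sup>2 = |T' x| (1 - x\<^sup>2)\<close>.  As \<open>(1 - x\<^sup>2)\<^sup>2 p x\<close> is non-increasing,
  \<open>|T' x|\<^sup>2 p |T x| \<le> p x\<close>, and the criterion applies to \<open>\<gamma>\<close>.
\<close>

section \<open>Solutions of \<open>u'' + p u = 0\<close>\<close>

lemma antiderivative_on_interval:
  fixes f :: "real \<Rightarrow> real"
  assumes "a < b" and f: "continuous_on {a<..<b} f"
  shows "\<exists>F. F c = 0 \<and> (\<forall>x\<in>{a<..<b}. (F has_real_derivative f x) (at x))"
proof -
  have "isCont f x" if "a < x" "x < b" for x
    using f that by (simp add: continuous_on_eq_continuous_at)
  then obtain F where F: "\<And>x. a < x \<Longrightarrow> x < b \<Longrightarrow> (F has_vector_derivative f x) (at x)"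
    using einterval_antiderivative[of "ereal a" "ereal b" f] \<open>a < b\<close> by auto
  then show ?thesis
    by (intro exI[of _ "\<lambda>x. F x - F c"])
      (auto simp: has_real_derivative_iff_has_vector_derivative intro!: derivative_eq_intros)
qed

text \<open>This bound replaces integration of the estimate \<open>\<bar>f' t\<bar> \<le> K (t - a)\<^sup>n\<close>; it produces the
  factorials that make the Picard series converge.\<close>

lemma abs_le_of_deriv_le_power_right:
  fixes f :: "real \<Rightarrow> real"
  assumes "a \<le> x" "f a = 0"
    and f: "\<And>t. a \<le> t \<Longrightarrow> t \<le> x \<Longrightarrow> (f has_real_derivative f' t) (at t)"
    and b: "\<And>t. a \<le> t \<Longrightarrow> t \<le> x \<Longrightarrow> \<bar>f' t\<bar> \<le> K * (t - a) ^ n"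
  shows "\<bar>f x\<bar> \<le> K * (x - a) ^ Suc n / Suc n"
proof -
  have g: "((\<lambda>t. K * (t - a) ^ Suc n / Suc n) has_real_derivative K * (t - a) ^ n) (at t)" for t
    by (auto intro!: derivative_eq_intros simp del: power_Suc of_nat_Suc)
  have "(\<lambda>t. K * (t - a) ^ Suc n / Suc n - f t) a \<le> (\<lambda>t. K * (t - a) ^ Suc n / Suc n - f t) x"
  proof (rule DERIV_nonneg_imp_nondecreasing[OF \<open>a \<le> x\<close>])
    fix t assume t: "a \<le> t" "t \<le> x"
    show "\<exists>y. ((\<lambda>t. K * (t - a) ^ Suc n / Suc n - f t) has_real_derivative y) (at t) \<and> 0 \<le> y"
      using DERIV_diff[OF g[of t] f[OF t]] b[OF t] by (intro exI conjI) (assumption, linarith)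
  qed
  moreover
  have "(\<lambda>t. K * (t - a) ^ Suc n / Suc n + f t) a \<le> (\<lambda>t. K * (t - a) ^ Suc n / Suc n + f t) x"
  proof (rule DERIV_nonneg_imp_nondecreasing[OF \<open>a \<le> x\<close>])
    fix t assume t: "a \<le> t" "t \<le> x"
    show "\<exists>y. ((\<lambda>t. K * (t - a) ^ Suc n / Suc n + f t) has_real_derivative y) (at t) \<and> 0 \<le> y"
      using DERIV_add[OF g[of t] f[OF t]] b[OF t] by (intro exI conjI) (assumption, linarith)
  qed
  ultimately show ?thesis
    using \<open>f a = 0\<close> by simp
qed

lemma abs_le_of_deriv_le_power:
  fixes f :: "real \<Rightarrow> real"
  assumes "f a = 0"
    and f: "\<And>t. t \<in> closed_segment a x \<Longrightarrow> (f has_real_derivative f' t) (at t)"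
    and b: "\<And>t. t \<in> closed_segment a x \<Longrightarrow> \<bar>f' t\<bar> \<le> K * \<bar>t - a\<bar> ^ n"
  shows "\<bar>f x\<bar> \<le> K * \<bar>x - a\<bar> ^ Suc n / Suc n"
proof (cases "a \<le> x")
  case True
  then show ?thesis
    using abs_le_of_deriv_le_power_right[of a x f f' K n] assms
    by (simp add: closed_segment_eq_real_ivl)
next
  case False
  have *: "((\<lambda>t. f (- t)) has_real_derivative - f' (- t)) (at t)" if "- a \<le> t" "t \<le> - x" for t
  proof -
    have "(f has_real_derivative f' (- t)) (at (- t))"
      using f[of "- t"] that False by (auto simp: closed_segment_eq_real_ivl)
    then show ?thesis
      using DERIV_mirror[of f "f' (- t)" t] by simp
  qed
  have **: "\<bar>- f' (- t)\<bar> \<le> K * (t - - a) ^ n" if "- a \<le> t" "t \<le> - x" for t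
    using b[of "- t"] that False by (auto simp: closed_segment_eq_real_ivl add.commute)
  show ?thesis
    using abs_le_of_deriv_le_power_right[of "- a" "- x" "\<lambda>t. f (- t)" "\<lambda>t. - f' (- t)" K n]
      * ** False \<open>f a = 0\<close> by simp
qed

text \<open>Disconjugacy speaks about solutions, so a solution with a prescribed zero has to be produced.
  It is the sum of the Picard series of the first-order system \<open>u' = v\<close>, \<open>v' = - p u\<close>.  The
  coefficient may blow up at \<open>\<plusminus>1\<close>, so convergence is uniform only on compact subintervals; the terms
  are nevertheless defined on the whole interval, and so no local solutions have to be glued.\<close>

lemma linear_ode_solution_exists:
  fixes p :: "real \<Rightarrow> real"
  assumes p: "continuous_on {-1<..<1} p" and a: "a \<in> {-1<..<1}"
  obtains y y' where "y a = 0" "y' a = 1"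
    "\<And>x. x \<in> {-1<..<1} \<Longrightarrow> (y has_real_derivative y' x) (at x)"
    "\<And>x. x \<in> {-1<..<1} \<Longrightarrow> (y' has_real_derivative - (p x * y x)) (at x)"
proof -
  define I :: "real set" where "I = {-1<..<1}"
  define prim where "prim f = (SOME F. F a = 0 \<and> (\<forall>x\<in>I. (F has_real_derivative f x) (at x)))"
    for f :: "real \<Rightarrow> real"
  have prim: "prim f a = 0" "\<And>x. x \<in> I \<Longrightarrow> (prim f has_real_derivative f x) (at x)"
    if "continuous_on I f" for f
  proof -
    have "\<exists>F. F a = 0 \<and> (\<forall>x\<in>I. (F has_real_derivative f x) (at x))"
      unfolding I_def by (rule antiderivative_on_interval) (use that in \<open>simp_all add: I_def\<close>)
    from someI_ex[OF this] have "prim f a = 0 \<and> (\<forall>x\<in>I. (prim f has_real_derivative f x) (at x))"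
      unfolding prim_def .
    then show "prim f a = 0" "\<And>x. x \<in> I \<Longrightarrow> (prim f has_real_derivative f x) (at x)"
      by blast+
  qed
  define Y where "Y = rec_nat (\<lambda>x. 0, \<lambda>x. 1) (\<lambda>_ (u, v). (prim v, prim (\<lambda>x. - (p x * u x))))"
  define u where "u n = fst (Y n)" for n
  define v where "v n = snd (Y n)" for n
  have u0: "u 0 = (\<lambda>x. 0)" and v0: "v 0 = (\<lambda>x. 1)"
    and uS: "\<And>n. u (Suc n) = prim (v n)"
    and vS: "\<And>n. v (Suc n) = prim (\<lambda>x. - (p x * u n x))"
    by (simp_all add: u_def v_def Y_def split_beta)
  have cont: "continuous_on I f" if "\<And>x. x \<in> I \<Longrightarrow> (f has_real_derivative g x) (at x)" for f g
    by (meson DERIV_isCont continuous_at_imp_continuous_on that)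
  have pI: "continuous_on I p" using p by (simp add: I_def)
  have uv: "continuous_on I (u n) \<and> continuous_on I (v n)" for n
  proof (induction n)
    case 0
    then show ?case by (simp add: u0 v0)
  next
    case (Suc n)
    have "continuous_on I (\<lambda>x. - (p x * u n x))"
      using Suc pI by (auto intro!: continuous_intros)
    from cont[OF prim(2)[OF this]] cont[OF prim(2), of "v n"] Suc show ?case
      by (simp add: uS vS)
  qed
  have cpu: "continuous_on I (\<lambda>x. - (p x * u n x))" for n
    using uv[of n] pI by (auto intro!: continuous_intros)
  \<comment> \<open>The derivative of the \<open>n\<close>-th term is made from the term of index \<open>n - 1\<close>.\<close>
  define u' where "u' n = (case n of 0 \<Rightarrow> (\<lambda>x. 0) | Suc m \<Rightarrow> v m)" for n
  define v' where "v' n = (case n of 0 \<Rightarrow> (\<lambda>x. 0) | Suc m \<Rightarrow> (\<lambda>x. - (p x * u m x)))" for n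
  have du: "(u n has_real_derivative u' n x) (at x)" if "x \<in> I" for n x
    using prim(2)[OF uv[THEN conjunct2]] that by (cases n) (auto simp: u0 u'_def uS)
  have dv: "(v n has_real_derivative v' n x) (at x)" if "x \<in> I" for n x
    using prim(2)[OF cpu] that by (cases n) (auto simp: v0 v'_def vS)
  have ua: "u n a = 0" for n
    using prim(1)[OF uv[THEN conjunct2]] by (cases n) (auto simp: u0 uS)
  have va: "v n a = (if n = 0 then 1 else 0)" for n
    using prim(1)[OF cpu] by (cases n) (auto simp: v0 vS)
  have main: "(\<Sum>n. u n a) = 0 \<and> (\<Sum>n. v n a) = 1 \<and>
      ((\<lambda>x. \<Sum>n. u n x) has_real_derivative (\<Sum>n. v n x)) (at x) \<and>
      ((\<lambda>x. \<Sum>n. v n x) has_real_derivative - (p x * (\<Sum>n. u n x))) (at x)" if x: "x \<in> I" for x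
  proof -
    obtain r where r: "\<bar>a\<bar> < r" "\<bar>x\<bar> < r" "r < 1"
      using dense[of "max \<bar>a\<bar> \<bar>x\<bar>" 1] a x by (auto simp: I_def abs_less_iff)
    define J where "J = {-r..r}"
    have JI: "J \<subseteq> I" using r by (auto simp: J_def I_def)
    have "compact (p ` J)"
      by (rule compact_continuous_image) (use pI JI in \<open>auto simp: J_def intro: continuous_on_subset\<close>)
    then obtain M0 where M0: "\<And>t. t \<in> J \<Longrightarrow> \<bar>p t\<bar> \<le> M0"
      using compact_imp_bounded[of "p ` J"] unfolding bounded_iff by auto
    define M where "M = max 1 M0"
    have M: "1 \<le> M" "\<And>t. t \<in> J \<Longrightarrow> \<bar>p t\<bar> \<le> M"
      using M0 by (force simp: M_def)+
    have seg: "closed_segment a t \<subseteq> J" if "t \<in> J" for t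
      using r that by (auto simp: J_def closed_segment_eq_real_ivl)
    \<comment> \<open>\<open>M \<ge> 1\<close> lets one constant serve both equations of the system.\<close>
    have bound: "\<bar>u n t\<bar> \<le> M ^ n * \<bar>t - a\<bar> ^ n / fact n \<and> \<bar>v n t\<bar> \<le> M ^ n * \<bar>t - a\<bar> ^ n / fact n"
      if "t \<in> J" for n t using that
    proof (induction n arbitrary: t)
      case 0
      then show ?case by (simp add: u0 v0)
    next
      case (Suc n)
      let ?K = "M ^ Suc n / fact n"
      have step: "M ^ n * \<bar>s - a\<bar> ^ n / fact n \<le> ?K * \<bar>s - a\<bar> ^ n" for s
      proof -
        have "1 * (M ^ n * \<bar>s - a\<bar> ^ n / fact n) \<le> M * (M ^ n * \<bar>s - a\<bar> ^ n / fact n)"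
          using M(1) by (intro mult_right_mono) auto
        then show ?thesis by (simp add: field_simps)
      qed
      have "\<bar>u (Suc n) t\<bar> \<le> ?K * \<bar>t - a\<bar> ^ Suc n / Suc n"
      proof (rule abs_le_of_deriv_le_power[of _ _ _ "u' (Suc n)"])
        show "u (Suc n) a = 0" by (simp add: ua)
        fix s assume s: "s \<in> closed_segment a t"
        with seg Suc.prems have sJ: "s \<in> J" by blast
        with JI du show "(u (Suc n) has_real_derivative u' (Suc n) s) (at s)" by blast
        show "\<bar>u' (Suc n) s\<bar> \<le> ?K * \<bar>s - a\<bar> ^ n"
          using Suc.IH[OF sJ] step[of s] by (simp add: u'_def)
      qed
      moreover have "\<bar>v (Suc n) t\<bar> \<le> ?K * \<bar>t - a\<bar> ^ Suc n / Suc n"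
      proof (rule abs_le_of_deriv_le_power[of _ _ _ "v' (Suc n)"])
        show "v (Suc n) a = 0" by (simp add: va)
        fix s assume s: "s \<in> closed_segment a t"
        with seg Suc.prems have sJ: "s \<in> J" by blast
        with JI dv show "(v (Suc n) has_real_derivative v' (Suc n) s) (at s)" by blast
        have "\<bar>p s * u n s\<bar> \<le> M * (M ^ n * \<bar>s - a\<bar> ^ n / fact n)"
          unfolding abs_mult using Suc.IH[OF sJ] M(1) M(2)[OF sJ] by (intro mult_mono) auto
        then show "\<bar>v' (Suc n) s\<bar> \<le> ?K * \<bar>s - a\<bar> ^ n"
          by (simp add: v'_def field_simps)
      qed
      moreover have "?K * \<bar>t - a\<bar> ^ Suc n / Suc n = M ^ Suc n * \<bar>t - a\<bar> ^ Suc n / fact (Suc n)"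
        by (simp add: fact_Suc mult.commute del: power_Suc)
      ultimately show ?case by (simp only: simp_thms)
    qed
    let ?B = "\<lambda>n. (2 * M) ^ n / fact n"
    have B: "summable ?B"
      using summable_exp_generic[of "2 * M"] by (simp add: divide_inverse mult.commute)
    have MB: "M ^ n * \<bar>t - a\<bar> ^ n / fact n \<le> ?B n" if "t \<in> J" for n t
    proof -
      have "\<bar>t - a\<bar> ^ n \<le> 2 ^ n"
        using that r by (intro power_mono) (auto simp: J_def)
      then show ?thesis
        using M(1) by (auto simp: power_mult_distrib mult.commute intro!: divide_right_mono mult_left_mono)
    qed
    have ub: "norm (u n t) \<le> ?B n" and vb: "norm (v n t) \<le> ?B n" if "t \<in> J" for n t
      using bound[OF that, of n] MB[OF that, of n] by auto
    have su: "summable (\<lambda>n. u n t)" and sv: "summable (\<lambda>n. v n t)" if "t \<in> J" for t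
      using B ub[OF that] vb[OF that] by (auto intro: summable_comparison_test')
    let ?B' = "\<lambda>n. M * (case n of 0 \<Rightarrow> 0 | Suc m \<Rightarrow> ?B m)"
    have B': "summable ?B'"
      using B by (intro summable_mult) (subst summable_Suc_iff[symmetric], simp)
    have B0: "?B n \<le> M * ?B n" for n
      using M(1) mult_right_mono[of 1 M "?B n"] by auto
    have u'b: "norm (u' n t) \<le> ?B' n" if "t \<in> J" for n t
    proof (cases n)
      case (Suc m)
      then show ?thesis using vb[OF that, of m] B0[of m] by (simp add: u'_def)
    qed (simp add: u'_def)
    have v'b: "norm (v' n t) \<le> ?B' n" if "t \<in> J" for n t
    proof (cases n)
      case (Suc m)
      have "norm (p t * u m t) \<le> M * ?B m"
        unfolding norm_mult using ub[OF that] M(1) M(2)[OF that] by (intro mult_mono) auto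
      then show ?thesis using Suc by (simp add: v'_def)
    qed (simp add: v'_def)
    have xJ: "x \<in> interior J" and xJ': "x \<in> J" using r by (auto simp: J_def)
    have du': "((\<lambda>x. \<Sum>n. u n x) has_real_derivative (\<Sum>n. u' n x)) (at x)"
    proof (rule has_field_derivative_series'(2)[of J u u' x])
      show "convex J" by (simp add: J_def)
      show "(u n has_real_derivative u' n t) (at t within J)" if "t \<in> J" for n t
        using du[of t n] that JI by (auto intro: has_field_derivative_at_within)
      show "uniformly_convergent_on J (\<lambda>n t. \<Sum>i<n. u' i t)"
        by (rule Weierstrass_m_test'[OF u'b B'])
    qed (fact xJ' su[OF xJ'] xJ)+
    have dv': "((\<lambda>x. \<Sum>n. v n x) has_real_derivative (\<Sum>n. v' n x)) (at x)"
    proof (rule has_field_derivative_series'(2)[of J v v' x])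
      show "convex J" by (simp add: J_def)
      show "(v n has_real_derivative v' n t) (at t within J)" if "t \<in> J" for n t
        using dv[of t n] that JI by (auto intro: has_field_derivative_at_within)
      show "uniformly_convergent_on J (\<lambda>n t. \<Sum>i<n. v' i t)"
        by (rule Weierstrass_m_test'[OF v'b B'])
    qed (fact xJ' sv[OF xJ'] xJ)+
    have "(\<Sum>n. u' n x) = (\<Sum>n. v n x)"
      using suminf_split_head[of "\<lambda>n. u' n x"] summable_Suc_iff[of "\<lambda>n. u' n x"] sv[OF xJ']
      by (simp add: u'_def)
    moreover have "(\<Sum>n. v' n x) = - (p x * (\<Sum>n. u n x))"
    proof -
      have "summable (\<lambda>n. v' (Suc n) x)"
        using su[OF xJ'] by (auto simp: v'_def intro!: summable_minus summable_mult)
      then have "(\<Sum>n. v' n x) = (\<Sum>n. - (p x * u n x))"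
        using suminf_split_head[of "\<lambda>n. v' n x"] summable_Suc_iff[of "\<lambda>n. v' n x"]
        by (simp add: v'_def)
      also have "\<dots> = - (p x * (\<Sum>n. u n x))"
        using su[OF xJ'] by (simp add: suminf_minus suminf_mult summable_mult)
      finally show ?thesis .
    qed
    moreover have "(\<Sum>n. v n a) = 1"
      using sums_single[of 0 "\<lambda>_. 1::real"] by (simp add: va sums_iff cong: if_cong)
    ultimately show ?thesis
      using du' dv' by (simp add: ua)
  qed
  show ?thesis
    by (rule that[of "\<lambda>x. \<Sum>n. u n x" "\<lambda>x. \<Sum>n. v n x"]) (use main a in \<open>auto simp: I_def\<close>)
qed

section \<open>Sturm comparison\<close>

text \<open>Let \<open>y\<close> be the solution that vanishes at \<open>a\<close> with slope \<open>1\<close>; disconjugacy keeps it positive on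
  \<open>(a, b]\<close>.  The Wronskian \<open>w' y - w y'\<close> is non-decreasing there because \<open>w'' + p w \<ge> 0\<close>, and it tends
  to \<open>0\<close> at \<open>a\<close> because \<open>w'\<close> is bounded.  Hence it is non-negative and \<open>w / y\<close> is non-decreasing, which
  a positive function cannot be if it ends at \<open>w b / y b = 0\<close>.  Derivatives are
  required only between the end points, where the distance function used below is smooth.\<close>

lemma sturm_no_positive_bump:
  fixes p w :: "real \<Rightarrow> real"
  assumes p: "nehari_function p" and ab: "-1 < a" "a < b" "b < 1"
    and w: "continuous_on {a..b} w" "w a = 0" "w b = 0"
    and pos: "\<And>t. a < t \<Longrightarrow> t < b \<Longrightarrow> w t > 0"
    and w1: "\<And>t. a < t \<Longrightarrow> t < b \<Longrightarrow> (w has_real_derivative w1 t) (at t)"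
    and w2: "\<And>t. a < t \<Longrightarrow> t < b \<Longrightarrow> (w1 has_real_derivative w2 t) (at t)"
    and ineq: "\<And>t. a < t \<Longrightarrow> t < b \<Longrightarrow> w2 t + p t * w t \<ge> 0"
    and bd: "\<And>t. a < t \<Longrightarrow> t < b \<Longrightarrow> \<bar>w1 t\<bar> \<le> C"
  shows False
proof -
  have cp: "continuous_on {-1<..<1} p"
    using p by (simp add: nehari_function_def)
  obtain y y' where y: "y a = 0" "y' a = 1"
    and dy: "\<And>x. x \<in> {-1<..<1} \<Longrightarrow> (y has_real_derivative y' x) (at x)"
    and dy': "\<And>x. x \<in> {-1<..<1} \<Longrightarrow> (y' has_real_derivative - (p x * y x)) (at x)"
    using linear_ode_solution_exists[OF cp, of a] ab by auto
  have cy: "isCont y x" and cy': "isCont y' x" if "x \<in> {-1<..<1}" for x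
    using dy[OF that] dy'[OF that] by (auto intro: DERIV_isCont)
  have sol: "ode_solution p y"
    unfolding ode_solution_def using dy dy' by (intro exI[of _ y'] ballI conjI)
  obtain d where d: "d > 0" "\<And>h. 0 < h \<Longrightarrow> h < d \<Longrightarrow> 0 < y (a + h)"
    using DERIV_pos_inc_right[OF dy[of a]] ab y by auto
  define e where "e = min d (b - a) / 2"
  have e: "0 < e" "e < d" "a + e < b" using d(1) ab by (auto simp: e_def min_def field_simps)
  have ye: "0 < y (a + e)" using d(2) e by blast
  have ynz: "y x \<noteq> 0" if "a < x" "x \<le> b" for x
  proof
    assume "y x = 0"
    then have "\<exists>x\<in>{-1<..<1}. \<exists>z\<in>{-1<..<1}. x \<noteq> z \<and> y x = 0 \<and> y z = 0"
      using that ab y(1) by (intro bexI[of _ a] bexI[of _ x]) auto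
    moreover have "\<exists>x\<in>{-1<..<1}. y x \<noteq> 0"
      using ye e ab by (intro bexI[of _ "a + e"]) auto
    ultimately show False
      using p sol unfolding nehari_function_def by blast
  qed
  have ypos: "y x > 0" if x: "a < x" "x \<le> b" for x
  proof (rule ccontr)
    assume "\<not> y x > 0"
    then have neg: "y x < 0" using ynz[OF x] by linarith
    have "connected (y ` {a<..b})"
      using cy ab by (intro connected_continuous_image continuous_at_imp_continuous_on) auto
    moreover have "y x \<in> y ` {a<..b}" "y (a + e) \<in> y ` {a<..b}"
      using x e by auto
    ultimately have "0 \<in> y ` {a<..b}"
      using neg ye by (meson connectedD_interval less_imp_le)
    then show False using ynz by auto
  qed
  define W where "W t = w1 t * y t - w t * y' t" for t
  have dW: "(W has_real_derivative (w2 t + p t * w t) * y t) (at t)" if "a < t" "t < b" for t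
    unfolding W_def using w1[OF that] w2[OF that] dy[of t] dy'[of t] that ab
    by (auto intro!: derivative_eq_intros simp: algebra_simps)
  have Wmono: "W s \<le> W t" if "a < s" "s \<le> t" "t < b" for s t
    using that(2)
  proof (rule DERIV_nonneg_imp_nondecreasing)
    fix x assume "s \<le> x" "x \<le> t"
    then have x: "a < x" "x < b" using that by auto
    then have "0 \<le> (w2 x + p x * w x) * y x"
      using ineq[OF x] ypos[of x] by simp
    with dW[OF x] show "\<exists>z. (W has_real_derivative z) (at x) \<and> 0 \<le> z" by blast
  qed
  have Wlim: "(W \<longlongrightarrow> 0) (at_right a)"
  proof (rule tendsto_rabs_zero_cancel, rule tendsto_sandwich[of "\<lambda>_. 0"])
    show "\<forall>\<^sub>F t in at_right a. 0 \<le> \<bar>W t\<bar>" by simp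
    show "\<forall>\<^sub>F t in at_right a. \<bar>W t\<bar> \<le> C * \<bar>y t\<bar> + w t * \<bar>y' t\<bar>"
      using eventually_at_right_less[of a] eventually_at_right_real[OF ab(2)]
    proof eventually_elim
      case (elim t)
      have "\<bar>W t\<bar> \<le> \<bar>w1 t * y t\<bar> + \<bar>w t * y' t\<bar>"
        unfolding W_def by linarith
      also have "\<dots> \<le> C * \<bar>y t\<bar> + w t * \<bar>y' t\<bar>"
        unfolding abs_mult using bd[of t] pos[of t] elim by (intro add_mono mult_right_mono) auto
      finally show ?case .
    qed
    have "(w \<longlongrightarrow> w a) (at_right a)"
      using w(1) ab(2) by (simp add: continuous_on_Icc_at_rightD)
    moreover have "(y \<longlongrightarrow> y a) (at_right a)" "(y' \<longlongrightarrow> y' a) (at_right a)"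
      using cy[of a] cy'[of a] ab by (auto simp: isCont_def intro: filterlim_at_split[THEN iffD1, THEN conjunct2])
    ultimately have "((\<lambda>t. C * \<bar>y t\<bar> + w t * \<bar>y' t\<bar>) \<longlongrightarrow> C * \<bar>y a\<bar> + w a * \<bar>y' a\<bar>) (at_right a)"
      by (intro tendsto_intros)
    then show "((\<lambda>t. C * \<bar>y t\<bar> + w t * \<bar>y' t\<bar>) \<longlongrightarrow> 0) (at_right a)"
      using w y by simp
  qed simp
  have Wnn: "0 \<le> W t" if "a < t" "t < b" for t
  proof (rule tendsto_upperbound[OF Wlim])
    show "\<forall>\<^sub>F s in at_right a. W s \<le> W t"
      using eventually_at_right_less[of a] eventually_at_right_real[OF that(1)]
      by eventually_elim (use Wmono that in auto)
  qed simp
  define m where "m = (a + b) / 2"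
  have m: "a < m" "m < b" using ab by (auto simp: m_def)
  have "w m / y m \<le> w b / y b"
  proof (rule DERIV_nonneg_imp_increasing_open[where f = "\<lambda>t. w t / y t"])
    show "m \<le> b" using m by simp
    show "\<exists>z. ((\<lambda>t. w t / y t) has_real_derivative z) (at t) \<and> 0 \<le> z" if "m < t" "t < b" for t
    proof -
      have t: "a < t" "t < b" using that m by auto
      have "((\<lambda>t. w t / y t) has_real_derivative W t / (y t * y t)) (at t)"
        unfolding W_def using w1[OF t] dy[of t] ypos[of t] t ab
        by (auto intro!: derivative_eq_intros)
      moreover have "0 \<le> W t / (y t * y t)" using Wnn[OF t] by simp
      ultimately show ?thesis by blast
    qed
    have "continuous_on {m..b} w" using w(1) m by (auto intro: continuous_on_subset)
    moreover have "continuous_on {m..b} y"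
      using cy m ab by (intro continuous_at_imp_continuous_on) auto
    ultimately show "continuous_on {m..b} (\<lambda>t. w t / y t)"
      using ypos m by (intro continuous_on_divide) (auto simp: less_imp_neq[symmetric])
  qed
  moreover have "0 < w m / y m" using pos[OF m] ypos[of m] m by simp
  ultimately show False using w(3) by simp
qed

section \<open>Ahlfors' Schwarzian of a curve\<close>

lemma has_real_derivative_inner:
  fixes f g :: "real \<Rightarrow> 'a::real_inner"
  assumes "(f has_vector_derivative f') (at t)" "(g has_vector_derivative g') (at t)"
  shows "((\<lambda>t. f t \<bullet> g t) has_real_derivative (f t \<bullet> g' + f' \<bullet> g t)) (at t)"
  using assms unfolding has_vector_derivative_def has_field_derivative_def
  by (auto intro!: derivative_eq_intros simp: algebra_simps fun_eq_iff)

text \<open>The arguments are the first three derivatives of the curve.  For a curve in the plane this is the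
  real part of the classical Schwarzian \<open>c / a - 3/2 (b / a)\<^sup>2\<close>.\<close>

definition ahlfors_schwarzian :: "'a::real_inner \<Rightarrow> 'a \<Rightarrow> 'a \<Rightarrow> real" where
  "ahlfors_schwarzian a b c =
     (a \<bullet> c) / (a \<bullet> a) - 3 * (a \<bullet> b)\<^sup>2 / (a \<bullet> a)\<^sup>2 + 3/2 * (b \<bullet> b) / (a \<bullet> a)"

text \<open>The heart of the one-dimensional criterion.  For a curve \<open>r\<close> with derivatives \<open>a, b, c\<close>, the left
  side is \<open>w'' / w\<close> for \<open>w = |r| |a|\<^bsup>-1/2\<^esup>\<close>.  The vector on the right is \<open>|a|\<^sup>2 / |r|\<^sup>2\<close> times the
  component of \<open>r\<close> normal to the curve plus half of the component of \<open>b\<close> normal to it.  So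
  \<open>w'' / w\<close> differs from minus half the Schwarzian by a square.  Conceptually, \<open>w\<close> is the inverse square
  root of the speed of the inverted curve \<open>r / |r|\<^sup>2\<close>, Ahlfors' Schwarzian is invariant under
  inversion, and the square is the contribution of the curvature of the inverted curve.\<close>

lemma ahlfors_schwarzian_identity:
  fixes r a b c :: "'a::real_inner"
  assumes "r \<noteq> 0" "a \<noteq> 0"
  shows "(a \<bullet> a + r \<bullet> b) / (r \<bullet> r) - 2 * (r \<bullet> a)\<^sup>2 / (r \<bullet> r)\<^sup>2
         - (b \<bullet> b + a \<bullet> c) / (2 * (a \<bullet> a)) + (a \<bullet> b)\<^sup>2 / (a \<bullet> a)\<^sup>2
         + ((r \<bullet> a) / (r \<bullet> r) - (a \<bullet> b) / (2 * (a \<bullet> a)))\<^sup>2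
       = (norm (((a \<bullet> a) / (r \<bullet> r)) *\<^sub>R r - ((r \<bullet> a) / (r \<bullet> r)) *\<^sub>R a
                 + (1/2) *\<^sub>R b - ((a \<bullet> b) / (2 * (a \<bullet> a))) *\<^sub>R a))\<^sup>2 / (a \<bullet> a)
         - ahlfors_schwarzian a b c / 2"
proof -
  define P Q k m n B cc where "P = r \<bullet> r" and "Q = a \<bullet> a" and "k = r \<bullet> a" and "m = a \<bullet> b"
    and "n = r \<bullet> b" and "B = b \<bullet> b" and "cc = a \<bullet> c"
  have [simp]: "P \<noteq> 0" "Q \<noteq> 0" using assms by (auto simp: P_def Q_def)
  have com: "a \<bullet> r = k" "b \<bullet> a = m" "b \<bullet> r = n"
    by (simp_all add: k_def m_def n_def inner_commute)
  have "(norm ((Q / P) *\<^sub>R r - (k / P) *\<^sub>R a + (1/2) *\<^sub>R b - (m / (2 * Q)) *\<^sub>R a))\<^sup>2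
      = (Q/P)\<^sup>2 * P + (k/P)\<^sup>2 * Q + B / 4 + (m / (2*Q))\<^sup>2 * Q
        - 2 * (Q/P) * (k/P) * k + (Q/P) * n - 2 * (Q/P) * (m/(2*Q)) * k
        - (k/P) * m + 2 * (k/P) * (m/(2*Q)) * Q - (m/(2*Q)) * m"
    unfolding power2_norm_eq_inner
    by (simp add: inner_add_left inner_add_right inner_diff_left inner_diff_right com
        flip: P_def Q_def k_def m_def n_def B_def)
      (simp add: power2_eq_square field_simps)
  then show ?thesis
    unfolding ahlfors_schwarzian_def
    by (simp flip: P_def Q_def k_def m_def n_def B_def cc_def)
      (simp add: power2_eq_square field_simps)
qed

lemma has_real_derivative_weighted_distance:
  fixes r a :: "real \<Rightarrow> 'a::real_inner"
  assumes r: "(r has_vector_derivative a t) (at t)" and a: "(a has_vector_derivative b) (at t)"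
    and nz: "r t \<noteq> 0" "a t \<noteq> 0"
  shows "((\<lambda>t. norm (r t) / sqrt (norm (a t))) has_real_derivative
           norm (r t) / sqrt (norm (a t)) * ((r t \<bullet> a t) / (r t \<bullet> r t) - (a t \<bullet> b) / (2 * (a t \<bullet> a t)))) (at t)"
proof -
  define P Q where "P t = r t \<bullet> r t" and "Q t = a t \<bullet> a t" for t
  define x q where "x = sqrt (P t)" and "q = sqrt (sqrt (Q t))"
  have pos: "0 < P t" "0 < Q t" using nz by (auto simp: P_def Q_def)
  have xq: "0 < x" "0 < q" using pos by (auto simp: x_def q_def)
  have q2: "sqrt (Q t) = q\<^sup>2" and PQ: "P t = x\<^sup>2" "Q t = q ^ 4"
    using pos power_mult[of q 2 2] by (auto simp: x_def q_def)
  have dP: "(P has_real_derivative 2 * (r t \<bullet> a t)) (at t)"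
    using has_real_derivative_inner[OF r r] by (simp add: P_def[abs_def] inner_commute)
  have dQ: "(Q has_real_derivative 2 * (a t \<bullet> b)) (at t)"
    using has_real_derivative_inner[OF a a] by (simp add: Q_def[abs_def] inner_commute)
  have 1: "((\<lambda>t. sqrt (P t)) has_real_derivative inverse x / 2 * (2 * (r t \<bullet> a t))) (at t)"
    unfolding x_def by (rule DERIV_chain2[OF DERIV_real_sqrt[OF pos(1)] dP])
  have "((\<lambda>t. sqrt (Q t)) has_real_derivative inverse (q\<^sup>2) / 2 * (2 * (a t \<bullet> b))) (at t)"
    unfolding q2[symmetric] by (rule DERIV_chain2[OF DERIV_real_sqrt[OF pos(2)] dQ])
  then have 2: "((\<lambda>t. sqrt (sqrt (Q t))) has_real_derivative
      inverse q / 2 * (inverse (q\<^sup>2) / 2 * (2 * (a t \<bullet> b)))) (at t)"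
    unfolding q_def by (intro DERIV_chain2[OF DERIV_real_sqrt]) (use pos in simp_all)
  have "((\<lambda>t. sqrt (P t) / sqrt (sqrt (Q t))) has_real_derivative
      (inverse x / 2 * (2 * (r t \<bullet> a t)) * q - x * (inverse q / 2 * (inverse (q\<^sup>2) / 2 * (2 * (a t \<bullet> b)))))
       / (q * q)) (at t)"
    using DERIV_divide[OF 1 2] xq unfolding x_def[symmetric] q_def[symmetric] by blast
  also have "(inverse x / 2 * (2 * (r t \<bullet> a t)) * q - x * (inverse q / 2 * (inverse (q\<^sup>2) / 2 * (2 * (a t \<bullet> b)))))
       / (q * q) = x / q * ((r t \<bullet> a t) / P t - (a t \<bullet> b) / (2 * Q t))"
    unfolding PQ using xq by (simp add: field_simps power2_eq_square power4_eq_xxxx)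
  finally show ?thesis
    by (simp add: P_def Q_def x_def q_def norm_eq_sqrt_inner)
qed

lemma has_real_derivative_weighted_distance_logderiv:
  fixes r a b :: "real \<Rightarrow> 'a::real_inner"
  assumes r: "(r has_vector_derivative a t) (at t)" and a: "(a has_vector_derivative b t) (at t)"
    and b: "(b has_vector_derivative c) (at t)"
    and nz: "r t \<noteq> 0" "a t \<noteq> 0"
  shows "((\<lambda>t. (r t \<bullet> a t) / (r t \<bullet> r t) - (a t \<bullet> b t) / (2 * (a t \<bullet> a t))) has_real_derivative
           (a t \<bullet> a t + r t \<bullet> b t) / (r t \<bullet> r t) - 2 * (r t \<bullet> a t)\<^sup>2 / (r t \<bullet> r t)\<^sup>2
         - (b t \<bullet> b t + a t \<bullet> c) / (2 * (a t \<bullet> a t)) + (a t \<bullet> b t)\<^sup>2 / (a t \<bullet> a t)\<^sup>2) (at t)"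
proof -
  have 1: "r t \<bullet> r t \<noteq> 0" "2 * (a t \<bullet> a t) \<noteq> 0" using nz by auto
  show ?thesis
    by (rule DERIV_cong[OF DERIV_diff[OF
            DERIV_divide[OF has_real_derivative_inner[OF r a] has_real_derivative_inner[OF r r] 1(1)]
            DERIV_divide[OF has_real_derivative_inner[OF a b]
              DERIV_cmult[OF has_real_derivative_inner[OF a a], of 2] 1(2)]]])
      (use 1 in \<open>simp add: field_simps power2_eq_square inner_commute\<close>)
qed

text \<open>If the curve returned to a point, then its distance from this point, divided by the square root of
  the speed, would be a positive bump over a maximal interval on which the point is avoided; the identity
  above shows that the bump \<open>w\<close> satisfies \<open>w'' + p w \<ge> 0\<close>, which Sturm comparison excludes.\<close>

theorem inj_on_if_ahlfors_schwarzian_le: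
  fixes \<gamma> \<gamma>1 \<gamma>2 \<gamma>3 :: "real \<Rightarrow> 'a::real_inner"
  assumes p: "nehari_function p"
    and d0: "\<And>t. t \<in> {-1<..<1} \<Longrightarrow> (\<gamma> has_vector_derivative \<gamma>1 t) (at t)"
    and d1: "\<And>t. t \<in> {-1<..<1} \<Longrightarrow> (\<gamma>1 has_vector_derivative \<gamma>2 t) (at t)"
    and d2: "\<And>t. t \<in> {-1<..<1} \<Longrightarrow> (\<gamma>2 has_vector_derivative \<gamma>3 t) (at t)"
    and nz: "\<And>t. t \<in> {-1<..<1} \<Longrightarrow> \<gamma>1 t \<noteq> 0"
    and S: "\<And>t. t \<in> {-1<..<1} \<Longrightarrow> ahlfors_schwarzian (\<gamma>1 t) (\<gamma>2 t) (\<gamma>3 t) \<le> 2 * p t"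
  shows "inj_on \<gamma> {-1<..<1}"
proof (rule linorder_inj_onI)
  fix x1 x2 :: real
  assume x12: "x1 < x2" "x1 \<in> {-1<..<1}" "x2 \<in> {-1<..<1}"
  show "\<gamma> x1 \<noteq> \<gamma> x2"
  proof
    assume eq: "\<gamma> x1 = \<gamma> x2"
    define r where "r t = \<gamma> t - \<gamma> x1" for t
    have dr: "(r has_vector_derivative \<gamma>1 t) (at t)" if "t \<in> {-1<..<1}" for t
      unfolding r_def using d0[OF that] by (auto intro!: derivative_eq_intros)
    have cont: "isCont f t" if "(f has_vector_derivative f') (at t)"
      for f :: "real \<Rightarrow> 'a" and f' t
      using that has_vector_derivative_continuous by blast
    have c: "isCont r t" "isCont \<gamma>1 t" "isCont \<gamma>2 t" if "t \<in> {-1<..<1}" for t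
      using cont dr[OF that] d1[OF that] d2[OF that] by blast+
    have "\<exists>t\<in>{x1<..<x2}. r t \<noteq> 0"
    proof (rule ccontr)
      assume "\<not> ?thesis"
      then have 0: "r t = 0" if "t \<in> {x1<..<x2}" for t using that by blast
      define m where "m = (x1 + x2) / 2"
      have m: "m \<in> {x1<..<x2}" "m \<in> {-1<..<1}" using x12 by (auto simp: m_def)
      have "((\<lambda>_. 0) has_vector_derivative \<gamma>1 m) (at m)"
        by (rule has_vector_derivative_transform_within_open[OF dr[OF m(2)] _ m(1)]) (use 0 in auto)
      then have "\<gamma>1 m = 0"
        using vector_derivative_at vector_derivative_const_at by metis
      with nz m show False by blast
    qed
    then obtain t where t: "x1 < t" "t < x2" "r t \<noteq> 0" by auto
    \<comment> \<open>The maximal interval around \<open>t\<close> that avoids the zeros of \<open>r\<close>.\<close>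
    have cp: "compact {s \<in> {u..v}. r s = 0}" if "-1 < u" "v < 1" for u v
    proof -
      have "closed {s \<in> {u..v}. r s = 0}"
        by (intro continuous_closed_preimage_constant continuous_at_imp_continuous_on)
          (use c that in auto)
      moreover have "bounded {s \<in> {u..v}. r s = 0}"
        by (rule bounded_subset[of "{u..v}"]) auto
      ultimately show ?thesis by (simp add: compact_eq_bounded_closed)
    qed
    have "\<exists>a\<in>{s \<in> {x1..t}. r s = 0}. \<forall>s\<in>{s \<in> {x1..t}. r s = 0}. s \<le> a"
      by (rule compact_attains_sup[OF cp]) (use x12 t in \<open>auto simp: r_def intro!: exI[of _ x1]\<close>)
    then obtain a where "a \<in> {s \<in> {x1..t}. r s = 0}" "\<forall>s\<in>{s \<in> {x1..t}. r s = 0}. s \<le> a"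
      by (elim bexE)
    then have a: "x1 \<le> a" "a \<le> t" "r a = 0" "\<And>s. a < s \<Longrightarrow> s \<le> t \<Longrightarrow> r s \<noteq> 0"
      by (simp_all, meson less_imp_le not_le order_trans)
    have "\<exists>b\<in>{s \<in> {t..x2}. r s = 0}. \<forall>s\<in>{s \<in> {t..x2}. r s = 0}. b \<le> s"
      by (rule compact_attains_inf[OF cp]) (use x12 t eq in \<open>auto simp: r_def intro!: exI[of _ x2]\<close>)
    then obtain b where "b \<in> {s \<in> {t..x2}. r s = 0}" "\<forall>s\<in>{s \<in> {t..x2}. r s = 0}. b \<le> s"
      by (elim bexE)
    then have b: "t \<le> b" "b \<le> x2" "r b = 0" "\<And>s. s < b \<Longrightarrow> t \<le> s \<Longrightarrow> r s \<noteq> 0"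
      by (simp_all, meson less_imp_le not_le order_trans)
    have rnz: "r s \<noteq> 0" if "a < s" "s < b" for s
      using a(4)[of s] b(4)[of s] that by linarith
    have ab: "-1 < a" "a < b" "b < 1" using a b t x12 by (auto simp: order_less_le)
    have in_I: "s \<in> {-1<..<1}" if "a \<le> s" "s \<le> b" for s using that ab by auto
    \<comment> \<open>\<open>L\<close> is the logarithmic derivative of \<open>w\<close>, \<open>L'\<close> is the derivative of \<open>L\<close>, and \<open>G\<close> is a continuous
      bound for \<open>\<bar>w'\<bar>\<close>, obtained from Cauchy--Schwarz, that remains finite at the zeros of \<open>r\<close>.\<close>
    define w where "w s = norm (r s) / sqrt (norm (\<gamma>1 s))" for s
    define L where "L s = (r s \<bullet> \<gamma>1 s) / (r s \<bullet> r s) - (\<gamma>1 s \<bullet> \<gamma>2 s) / (2 * (\<gamma>1 s \<bullet> \<gamma>1 s))" for s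
    define L' where "L' s = (\<gamma>1 s \<bullet> \<gamma>1 s + r s \<bullet> \<gamma>2 s) / (r s \<bullet> r s) - 2 * (r s \<bullet> \<gamma>1 s)\<^sup>2 / (r s \<bullet> r s)\<^sup>2
         - (\<gamma>2 s \<bullet> \<gamma>2 s + \<gamma>1 s \<bullet> \<gamma>3 s) / (2 * (\<gamma>1 s \<bullet> \<gamma>1 s)) + (\<gamma>1 s \<bullet> \<gamma>2 s)\<^sup>2 / (\<gamma>1 s \<bullet> \<gamma>1 s)\<^sup>2" for s
    define G where "G s = sqrt (norm (\<gamma>1 s)) + w s * norm (\<gamma>2 s) / (2 * norm (\<gamma>1 s))" for s
    have dw: "(w has_real_derivative w s * L s) (at s)" if "a < s" "s < b" for s
      unfolding w_def L_def using that ab rnz[OF that] nz[of s] dr[of s] d1[of s]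
      by (intro has_real_derivative_weighted_distance) auto
    have dL: "(L has_real_derivative L' s) (at s)" if "a < s" "s < b" for s
      unfolding L_def L'_def using that ab rnz[OF that] nz[of s] dr[of s] d1[of s] d2[of s]
      by (intro has_real_derivative_weighted_distance_logderiv) auto
    have "compact (G ` {a..b})"
      unfolding G_def w_def
      by (intro compact_continuous_image continuous_at_imp_continuous_on)
        (use c nz in_I in \<open>auto intro!: continuous_intros\<close>)
    then obtain C where C: "\<bar>G s\<bar> \<le> C" if "a \<le> s" "s \<le> b" for s
      using compact_imp_bounded[of "G ` {a..b}"] unfolding bounded_iff real_norm_def
      by (metis atLeastAtMost_iff imageI)
    show False
    proof (rule sturm_no_positive_bump[OF p ab])
      show "continuous_on {a..b} w"
        unfolding w_def
        by (intro continuous_at_imp_continuous_on) (use c nz in_I in \<open>auto intro!: continuous_intros\<close>)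
      show "w a = 0" "w b = 0" using a b by (auto simp: w_def)
    next
      fix s assume s: "a < s" "s < b"
      have rs: "r s \<noteq> 0" and gs: "\<gamma>1 s \<noteq> 0" using rnz s nz in_I by auto
      show ws: "0 < w s" using rs gs by (simp add: w_def)
      show "(w has_real_derivative w s * L s) (at s)" by (rule dw[OF s])
      show "((\<lambda>s. w s * L s) has_real_derivative w s * (L' s + (L s)\<^sup>2)) (at s)"
        by (rule DERIV_cong[OF DERIV_mult[OF dw[OF s] dL[OF s]]])
          (simp add: algebra_simps power2_eq_square)
      have "L' s + (L s)\<^sup>2 \<ge> - ahlfors_schwarzian (\<gamma>1 s) (\<gamma>2 s) (\<gamma>3 s) / 2"
        unfolding L_def L'_def ahlfors_schwarzian_identity[OF rs gs] by simp
      then have "L' s + (L s)\<^sup>2 + p s \<ge> 0" using S[of s] in_I[of s] s by simp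
      then have "0 \<le> w s * (L' s + (L s)\<^sup>2 + p s)" using ws by simp
      then show "0 \<le> w s * (L' s + (L s)\<^sup>2) + p s * w s" by (simp add: algebra_simps)
      have "\<bar>L s\<bar> \<le> \<bar>r s \<bullet> \<gamma>1 s\<bar> / (r s \<bullet> r s) + \<bar>\<gamma>1 s \<bullet> \<gamma>2 s\<bar> / (2 * (\<gamma>1 s \<bullet> \<gamma>1 s))"
        unfolding L_def by (rule order_trans[OF abs_triangle_ineq4]) (simp add: abs_mult)
      also have "\<dots> \<le> norm (r s) * norm (\<gamma>1 s) / (r s \<bullet> r s) + norm (\<gamma>1 s) * norm (\<gamma>2 s) / (2 * (\<gamma>1 s \<bullet> \<gamma>1 s))"
        by (intro add_mono divide_right_mono Cauchy_Schwarz_ineq2) auto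
      also have "\<dots> = norm (\<gamma>1 s) / norm (r s) + norm (\<gamma>2 s) / (2 * norm (\<gamma>1 s))"
        using rs gs by (simp add: dot_square_norm power2_eq_square)
      finally have "w s * \<bar>L s\<bar> \<le> w s * (norm (\<gamma>1 s) / norm (r s) + norm (\<gamma>2 s) / (2 * norm (\<gamma>1 s)))"
        using ws by simp
      also have "\<dots> = G s"
        using rs gs by (simp add: G_def w_def field_simps)
      finally show "\<bar>w s * L s\<bar> \<le> C"
        using C[of s] s ws by (simp add: abs_mult)
    qed
  qed
qed auto

section \<open>Hermitian products and the algebra of the Schwarzian\<close>

definition herm :: "complex ^ 'n \<Rightarrow> complex ^ 'n \<Rightarrow> complex" where
  "herm a b = (\<Sum>i\<in>UNIV. a $ i * cnj (b $ i))"

lemma Re_herm: "Re (herm a b) = a \<bullet> b"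
  by (simp add: herm_def inner_vec_def inner_complex_def)

lemma cnj_herm: "cnj (herm a b) = herm b a"
  by (simp add: herm_def mult.commute)

lemma herm_self: "herm a a = complex_of_real ((norm a)\<^sup>2)"
  using Re_herm[of a a] cnj_herm[of a a]
  by (simp add: power2_norm_eq_inner complex_eq_iff)

lemma herm_linear:
  "herm (a + b) c = herm a c + herm b c" "herm c (a + b) = herm c a + herm c b"
  "herm (k *s a) b = k * herm a b" "herm a (k *s b) = cnj k * herm a b"
  by (simp_all add: herm_def algebra_simps sum.distrib sum_distrib_left)

text \<open>A real derivative of the form \<open>d \<mapsto> P d + Q cnj d\<close> has \<open>P\<close> and \<open>Q\<close> as its Wirtinger derivatives; all
  computations with \<open>\<sigma>\<close> below are done in this form.\<close>

lemma has_derivative_herm: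
  fixes f g :: "complex \<Rightarrow> complex ^ 'n"
  assumes "\<And>i. ((\<lambda>w. f w $ i) has_field_derivative f' $ i) (at z)"
    and "\<And>i. ((\<lambda>w. g w $ i) has_field_derivative g' $ i) (at z)"
  shows "((\<lambda>w. herm (f w) (g w)) has_derivative
           (\<lambda>d. herm f' (g z) * d + herm (f z) g' * cnj d)) (at z)"
proof -
  have "((\<lambda>w. f w $ i * cnj (g w $ i)) has_derivative
      (\<lambda>d. f z $ i * cnj (g' $ i * d) + f' $ i * d * cnj (g z $ i))) (at z)" for i
    using assms[of i] unfolding has_field_derivative_def
    by (intro has_derivative_mult has_derivative_cnj)
  then have "((\<lambda>w. herm (f w) (g w)) has_derivative
      (\<lambda>d. \<Sum>i\<in>UNIV. f z $ i * cnj (g' $ i * d) + f' $ i * d * cnj (g z $ i))) (at z)"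
    unfolding herm_def by (intro has_derivative_sum)
  moreover have "(\<Sum>i\<in>UNIV. f z $ i * cnj (g' $ i * d) + f' $ i * d * cnj (g z $ i))
      = herm f' (g z) * d + herm (f z) g' * cnj d" for d
    by (simp add: herm_def sum_distrib_left sum.distrib algebra_simps)
  ultimately show ?thesis by simp
qed

lemma partial_of_has_derivative:
  fixes f :: "complex \<Rightarrow> 'a::real_normed_vector"
  assumes f: "(f has_derivative L) (at z)"
  shows "partial_x f z = L 1" "partial_y f z = L \<i>"
proof -
  have lin: "L (d * complex_of_real t) = t *\<^sub>R L d" for d t
    using linear_scale[OF has_derivative_linear[OF f], of t d]
    by (simp add: scaleR_conv_of_real mult.commute)
  have "((\<lambda>t. f (z + d * complex_of_real t)) has_vector_derivative L d) (at 0)" for d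
  proof -
    have g: "((\<lambda>t. z + d * complex_of_real t) has_derivative (\<lambda>t. d * complex_of_real t)) (at 0)"
      by (auto intro!: derivative_eq_intros)
    have "(f has_derivative L) (at (z + d * complex_of_real 0))" using f by simp
    from has_derivative_compose[OF g this] show ?thesis
      unfolding has_vector_derivative_def lin .
  qed
  from this[of 1] this[of \<i>] show "partial_x f z = L 1" "partial_y f z = L \<i>"
    by (auto simp: partial_x_def partial_y_def vector_derivative_at)
qed

lemma wirtinger_of_has_derivative:
  assumes "(f has_derivative (\<lambda>d. P * d + Q * cnj d)) (at z)"
  shows "wirtinger f z = P"
  using partial_of_has_derivative[OF assms]
  by (simp add: wirtinger_def complex_eq_iff)

text \<open>The arguments \<open>a, b, c\<close> of the next two functions are the first three complex derivatives of a
  holomorphic curve.  They are the Schwarzian of the curve and half of \<open>|a|\<^sup>2 |K|\<close>, with \<open>K\<close> the Gaussian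
  curvature, written without reference to \<open>\<sigma>\<close>.\<close>

definition vec_schwarzian :: "complex ^ 'n \<Rightarrow> complex ^ 'n \<Rightarrow> complex ^ 'n \<Rightarrow> complex" where
  "vec_schwarzian a b c = herm c a / herm a a - 3/2 * (herm b a / herm a a)\<^sup>2"

definition vec_curvature :: "complex ^ 'n \<Rightarrow> complex ^ 'n \<Rightarrow> real" where
  "vec_curvature a b = (norm b)\<^sup>2 / (norm a)\<^sup>2 - (cmod (herm b a))\<^sup>2 / (norm a) ^ 4"

text \<open>This is where the constant \<open>3/4\<close> comes from: along a real line in the domain of a holomorphic curve,
  Ahlfors' Schwarzian is the real part of the complex one plus \<open>3/4 |a|\<^sup>2 |K|\<close>.\<close>

lemma ahlfors_schwarzian_eq_vec_schwarzian:
  assumes "a \<noteq> 0"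
  shows "ahlfors_schwarzian a b c = Re (vec_schwarzian a b c) + 3/2 * vec_curvature a b"
proof -
  define M where "M = a \<bullet> a"
  have M: "M \<noteq> 0" "(norm a)\<^sup>2 = M" "herm a a = complex_of_real M" "norm a ^ 4 = M\<^sup>2"
    using assms power_mult[of "norm a" 2 2] by (auto simp: M_def herm_self power2_norm_eq_inner)
  have "Re (vec_schwarzian a b c)
      = (a \<bullet> c) / M - 3/2 * ((Re (herm b a) / M)\<^sup>2 - (Im (herm b a) / M)\<^sup>2)"
    by (simp add: vec_schwarzian_def M Re_herm inner_commute[of a c]) (simp add: power2_eq_square Re_herm inner_commute right_diff_distrib diff_divide_distrib)
  moreover have "vec_curvature a b = (b \<bullet> b) / M - ((Re (herm b a))\<^sup>2 + (Im (herm b a))\<^sup>2) / M\<^sup>2"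
    by (simp add: vec_curvature_def M cmod_power2 flip: power2_norm_eq_inner)
  moreover have "Re (herm b a) = a \<bullet> b" by (simp add: Re_herm inner_commute)
  ultimately show ?thesis
    unfolding ahlfors_schwarzian_def M_def[symmetric] using M(1)
    by (simp add: field_simps power2_eq_square)
qed

text \<open>The vectors on the left are the derivatives of \<open>\<phi> \<circ> T\<close> if \<open>\<tau> = T'\<close>, \<open>T'' = 2 e \<tau>\<close> and
  \<open>T''' = 6 e\<^sup>2 \<tau>\<close>.  These relations say that the Schwarzian of \<open>T\<close> vanishes, that is, that \<open>T\<close> is a
  Moebius transformation; so the chain rule has no additional term.\<close>

lemma vec_schwarzian_reparametrize:
  assumes "a \<noteq> 0" "\<tau> \<noteq> 0"
  shows "vec_schwarzian (\<tau> *s a) (\<tau>\<^sup>2 *s b + (2 * e * \<tau>) *s a)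
           (\<tau> ^ 3 *s c + (6 * e * \<tau>\<^sup>2) *s b + (6 * e\<^sup>2 * \<tau>) *s a) = \<tau>\<^sup>2 * vec_schwarzian a b c"
proof -
  have "herm a a \<noteq> 0" using assms by (simp add: herm_self)
  then show ?thesis
    unfolding vec_schwarzian_def herm_linear using assms
    by (simp add: field_simps power2_eq_square power3_eq_cube)
qed

lemma of_real_vec_curvature:
  "complex_of_real (vec_curvature a b) = herm b b / herm a a - herm b a * herm a b / (herm a a)\<^sup>2"
proof -
  have "herm b a * herm a b = complex_of_real ((cmod (herm b a))\<^sup>2)"
    unfolding complex_norm_square cnj_herm ..
  then show ?thesis
    by (simp add: vec_curvature_def herm_self flip: power_mult)
qed

lemma vec_curvature_reparametrize:
  assumes "a \<noteq> 0" "\<tau> \<noteq> 0"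
  shows "vec_curvature (\<tau> *s a) (\<tau>\<^sup>2 *s b + (2 * e * \<tau>) *s a) = (cmod \<tau>)\<^sup>2 * vec_curvature a b"
proof -
  have "herm a a \<noteq> 0" using assms by (simp add: herm_self)
  then have "complex_of_real (vec_curvature (\<tau> *s a) (\<tau>\<^sup>2 *s b + (2 * e * \<tau>) *s a))
      = \<tau> * cnj \<tau> * complex_of_real (vec_curvature a b)"
    unfolding of_real_vec_curvature herm_linear using assms
    by (simp add: field_simps power2_eq_square)
  also have "\<dots> = complex_of_real ((cmod \<tau>)\<^sup>2 * vec_curvature a b)"
    by (simp only: of_real_mult complex_norm_square)
  finally show ?thesis by (simp only: of_real_eq_iff)
qed

section \<open>Schwarzian and curvature of a holomorphic curve\<close>

lemma holomorphic_curve_derivD: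
  assumes "holomorphic_curve_on \<phi> S" "open S"
  shows "holomorphic_curve_on (curve_deriv \<phi>) S"
    and "z \<in> S \<Longrightarrow> ((\<lambda>w. \<phi> w $ i) has_field_derivative curve_deriv \<phi> z $ i) (at z)"
  using assms unfolding holomorphic_curve_on_def curve_deriv_def
  by (auto intro: holomorphic_deriv holomorphic_derivI)

context
  fixes \<phi> :: "complex \<Rightarrow> complex ^ 'n" and S :: "complex set"
  assumes hol: "holomorphic_curve_on \<phi> S" and S: "open S"
    and nz: "\<And>z. z \<in> S \<Longrightarrow> curve_deriv \<phi> z \<noteq> 0"
begin

private abbreviation (input) "D1 \<equiv> curve_deriv \<phi>"
private abbreviation (input) "D2 \<equiv> curve_deriv D1"
private abbreviation (input) "D3 \<equiv> curve_deriv D2"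
private abbreviation (input) "\<beta> w \<equiv> herm (D2 w) (D1 w) / herm (D1 w) (D1 w)"

private lemmas D = holomorphic_curve_derivD(2)[OF hol S]
  holomorphic_curve_derivD(2)[OF holomorphic_curve_derivD(1)[OF hol S] S]
  holomorphic_curve_derivD(2)[OF holomorphic_curve_derivD(1)[OF holomorphic_curve_derivD(1)[OF hol S] S] S]

lemma has_derivative_log_speed:
  assumes z: "z \<in> S"
  shows "(log_speed \<phi> has_derivative (\<lambda>d. Re (\<beta> z * d))) (at z)"
proof -
  define M where "M w = Re (herm (D1 w) (D1 w))" for w
  have eq: "log_speed \<phi> = (\<lambda>w. 1/2 * ln (M w))"
    by (simp add: fun_eq_iff log_speed_def M_def herm_def complex_mult_cnj cmod_power2)
  have M: "M z > 0" "herm (D1 z) (D1 z) = complex_of_real (M z)"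
    using nz[OF z] by (auto simp: M_def herm_self)
  have "(M has_derivative (\<lambda>d. Re (herm (D2 z) (D1 z) * d + herm (D1 z) (D2 z) * cnj d))) (at z)"
    unfolding M_def by (intro has_derivative_Re has_derivative_herm D z)
  then have "((\<lambda>w. 1/2 * ln (M w)) has_derivative (\<lambda>d. 1/2 *
      (Re (herm (D2 z) (D1 z) * d + herm (D1 z) (D2 z) * cnj d) * inverse (M z)))) (at z)"
    using M(1) by (intro has_derivative_mult_right has_derivative_ln)
  moreover have "1/2 * (Re (herm (D2 z) (D1 z) * d + herm (D1 z) (D2 z) * cnj d) * inverse (M z))
      = Re (\<beta> z * d)" for d
    unfolding M cnj_herm[of "D2 z" "D1 z", symmetric] using M(1) by (simp add: field_simps)
  ultimately show ?thesis by (simp add: eq)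
qed

text \<open>The coefficient of \<open>cnj d\<close> is real, as it must be: \<open>\<beta> / 2\<close> is \<open>\<sigma>\<^sub>z\<close>, so it is half of the Laplacian
  of \<open>\<sigma>\<close>.\<close>

lemma has_derivative_beta:
  assumes z: "z \<in> S"
  shows "(\<beta> has_derivative (\<lambda>d. (vec_schwarzian (D1 z) (D2 z) (D3 z) + (\<beta> z)\<^sup>2 / 2) * d
           + complex_of_real (vec_curvature (D1 z) (D2 z)) * cnj d)) (at z)"
proof -
  have M: "herm (D1 z) (D1 z) \<noteq> 0" using nz[OF z] by (simp add: herm_self)
  show ?thesis
    by (rule has_derivative_eq_rhs[OF has_derivative_divide'[OF has_derivative_herm[OF D(3,2)]
        has_derivative_herm[OF D(2,2)] M]])
     (use M z in \<open>auto simp: fun_eq_iff vec_schwarzian_def of_real_vec_curvature field_simps power2_eq_square\<close>)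
qed

lemma schwarzian_eq_vec_schwarzian:
  assumes z: "z \<in> S"
  shows "schwarzian \<phi> z = vec_schwarzian (D1 z) (D2 z) (D3 z)"
proof -
  have half: "complex_of_real (Re (b * d)) = b / 2 * d + cnj b / 2 * cnj d" for b d
    by (simp add: complex_eq_iff add_divide_distrib diff_divide_distrib)
  define \<sigma>z where "\<sigma>z = wirtinger (\<lambda>w. complex_of_real (log_speed \<phi> w))"
  have \<sigma>z: "\<sigma>z w = \<beta> w / 2" if "w \<in> S" for w
    unfolding \<sigma>z_def
  proof (rule wirtinger_of_has_derivative[where Q = "cnj (\<beta> w) / 2"])
    show "((\<lambda>w. complex_of_real (log_speed \<phi> w)) has_derivative
        (\<lambda>d. \<beta> w / 2 * d + cnj (\<beta> w) / 2 * cnj d)) (at w)"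
      by (rule has_derivative_eq_rhs[OF has_derivative_of_real[OF has_derivative_log_speed[OF that]]])
        (simp only: half)
  qed
  have "wirtinger \<sigma>z z = (vec_schwarzian (D1 z) (D2 z) (D3 z) + (\<beta> z)\<^sup>2 / 2) / 2"
  proof (rule wirtinger_of_has_derivative[where Q = "complex_of_real (vec_curvature (D1 z) (D2 z)) / 2"],
      rule has_derivative_transform_within_open[OF _ S z])
    show "\<beta> w / 2 = \<sigma>z w" if "w \<in> S" for w using \<sigma>z[OF that] by simp
    show "((\<lambda>w. \<beta> w / 2) has_derivative
        (\<lambda>d. (vec_schwarzian (D1 z) (D2 z) (D3 z) + (\<beta> z)\<^sup>2 / 2) / 2 * d
          + complex_of_real (vec_curvature (D1 z) (D2 z)) / 2 * cnj d)) (at z)"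
      by (rule has_derivative_eq_rhs[OF bounded_linear.has_derivative[OF bounded_linear_divide[of 2] has_derivative_beta[OF z]]])
        (simp add: fun_eq_iff add_divide_distrib)
  qed
  then show ?thesis
    unfolding schwarzian_def Let_def \<sigma>z_def[symmetric] \<sigma>z[OF z]
    by (simp add: power_divide field_simps)
qed

lemma laplacian_log_speed_eq:
  assumes z: "z \<in> S"
  shows "laplacian (log_speed \<phi>) z = 2 * vec_curvature (D1 z) (D2 z)"
proof -
  let ?L = "\<lambda>d. (vec_schwarzian (D1 z) (D2 z) (D3 z) + (\<beta> z)\<^sup>2 / 2) * d
           + complex_of_real (vec_curvature (D1 z) (D2 z)) * cnj d"
  have Re_i: "Re (b * \<i>) = - Im b" for b by simp
  have x: "partial_x (log_speed \<phi>) w = Re (\<beta> w)" and y: "partial_y (log_speed \<phi>) w = - Im (\<beta> w)"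
    if "w \<in> S" for w
    using partial_of_has_derivative[OF has_derivative_log_speed[OF that]] Re_i
    by (simp_all only: mult_1_right)
  have "(partial_x (log_speed \<phi>) has_derivative (\<lambda>d. Re (?L d))) (at z)"
    by (rule has_derivative_transform_within_open[OF has_derivative_Re[OF has_derivative_beta[OF z]] S z])
      (simp add: x)
  moreover have "(partial_y (log_speed \<phi>) has_derivative (\<lambda>d. - Im (?L d))) (at z)"
    by (rule has_derivative_transform_within_open[OF has_derivative_minus[OF has_derivative_Im[OF has_derivative_beta[OF z]]] S z])
      (simp add: y)
  ultimately show ?thesis
    by (simp add: laplacian_def partial_of_has_derivative)
qed

lemma speed_curvature_eq:
  assumes z: "z \<in> S"
  shows "(norm (D1 z))\<^sup>2 * \<bar>gauss_curvature \<phi> z\<bar> = 2 * \<bar>vec_curvature (D1 z) (D2 z)\<bar>"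
proof -
  have "exp (- 2 * log_speed \<phi> z) = inverse ((norm (D1 z))\<^sup>2)"
    using exp_log_speed[OF nz[OF z]] by (simp add: exp_minus exp_double)
  then show ?thesis
    using nz[OF z] by (simp add: gauss_curvature_def laplacian_log_speed_eq[OF z] abs_mult)
qed

end

section \<open>Hyperbolic geodesics\<close>

lemma has_vector_derivative_vec:
  fixes f :: "real \<Rightarrow> complex ^ 'n"
  assumes "\<And>i. ((\<lambda>t. f t $ i) has_vector_derivative f' $ i) (at t)"
  shows "(f has_vector_derivative f') (at t)"
  unfolding has_vector_derivative_def
proof (subst has_derivative_componentwise_within, intro ballI)
  fix b :: "complex ^ 'n" assume "b \<in> Basis"
  then obtain j c where b: "b = axis j c" by (auto simp: Basis_vec_def)
  have "((\<lambda>t. f t $ j) has_derivative (\<lambda>h. h *\<^sub>R f' $ j)) (at t)"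
    using assms[of j] by (simp add: has_vector_derivative_def)
  from has_derivative_inner_left[OF this, of c]
  show "((\<lambda>t. f t \<bullet> b) has_derivative (\<lambda>h. h *\<^sub>R f' \<bullet> b)) (at t)"
    by (simp add: b inner_axis)
qed

lemma has_vector_derivative_scaled_curve:
  fixes f :: "complex \<Rightarrow> complex ^ 'n" and T s :: "real \<Rightarrow> complex"
  assumes T: "(T has_vector_derivative \<tau>) (at t)" and s: "(s has_vector_derivative s') (at t)"
    and f: "\<And>i. ((\<lambda>w. f w $ i) has_field_derivative f' $ i) (at (T t))"
  shows "((\<lambda>t. s t *s f (T t)) has_vector_derivative s' *s f (T t) + (s t * \<tau>) *s f') (at t)"
proof (rule has_vector_derivative_vec)
  fix i
  have "((\<lambda>t. f (T t) $ i) has_vector_derivative \<tau> * f' $ i) (at t)"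
    using field_vector_diff_chain_at[OF T f[of i]] by (simp add: o_def)
  from has_vector_derivative_mult[OF s this]
  show "((\<lambda>t. (s t *s f (T t)) $ i) has_vector_derivative (s' *s f (T t) + (s t * \<tau>) *s f') $ i) (at t)"
    by (simp add: algebra_simps)
qed

text \<open>For \<open>|a| < 1\<close> and \<open>|u| = 1\<close> this is the automorphism of the disk with value \<open>a\<close> at \<open>0\<close> and tangent
  direction \<open>u\<close> there; it maps \<open>(-1, 1)\<close> onto a hyperbolic geodesic through \<open>a\<close>.\<close>

definition geodesic :: "complex \<Rightarrow> complex \<Rightarrow> complex \<Rightarrow> complex" where
  "geodesic a u z = (u * z + a) / (1 + cnj a * u * z)"

text \<open>The orthogonality of \<open>a\<close> and \<open>u\<close> says that \<open>a\<close> is the point of the geodesic nearest to the origin.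
  The geodesic is first parametrized with \<open>z1\<close> at parameter \<open>0\<close> and \<open>z2\<close> at \<open>s0 > 0\<close>; then the base point
  is moved to parameter \<open>s\<close>, and orthogonality becomes a quadratic equation for \<open>s\<close>, which has a root in \<open>(-1, 1)\<close> by the intermediate value theorem.\<close>

lemma geodesic_through:
  assumes z: "z1 \<in> ball 0 1" "z2 \<in> ball 0 1" "z1 \<noteq> z2"
  obtains a u and x1 x2 :: real where "cmod a < 1" "cmod u = 1" "Re (cnj a * u) = 0"
    "x1 \<in> {-1<..<1}" "x2 \<in> {-1<..<1}"
    "geodesic a u x1 = z1" "geodesic a u x2 = z2"
proof -
  have n: "cmod z1 < 1" "cmod z2 < 1" using z by auto
  define k where "k = Moebius_function 0 z1 z2"
  define s0 where "s0 = cmod k"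
  define v where "v = k / s0"
  have s0: "0 \<le> s0" "s0 < 1"
    using Moebius_function_norm_lt_1[OF n(1,2), of 0] by (auto simp: s0_def k_def)
  have z2k: "z2 = Moebius_function 0 (- z1) k"
    unfolding k_def using Moebius_function_compose[of "- z1" z1 z2] n by simp
  have "k \<noteq> 0"
    using z2k z(3) by (auto simp: Moebius_function_def)
  then have s0nz: "s0 \<noteq> 0" by (simp add: s0_def)
  have v: "cmod v = 1" "k = v * s0" using s0nz by (auto simp: v_def s0_def norm_divide)
  have vv: "cnj v * v = 1" using v(1) complex_norm_square[of v] by (simp add: mult.commute)
  have vnz: "v \<noteq> 0" using v(1) by auto
  \<comment> \<open>After rotation by \<open>cnj v\<close> the two points are \<open>c\<close> and a point reached from \<open>c\<close> in direction \<open>1\<close>.\<close>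
  define c where "c = cnj v * z1"
  have z1: "z1 = v * c" using vv by (simp add: c_def mult.assoc[symmetric] mult.commute)
  have z2: "z2 = v * (s0 + c) / (1 + cnj c * s0)"
  proof -
    have "cnj z1 * k = cnj c * s0"
      using vv unfolding v(2) z1 by (simp add: mult_ac)
    then show ?thesis
      unfolding z2k by (simp add: Moebius_function_def v(2) z1 distrib_left)
  qed
  have c: "cmod c < 1" using n v by (simp add: c_def norm_mult)
  define b where "b = Re c"
  have b: "\<bar>b\<bar> \<le> cmod c"
    by (simp add: b_def abs_Re_le_cmod)
  have sq: "2 * cmod c < 1 + (cmod c)\<^sup>2"
    using c zero_less_power[of "1 - cmod c" 2] by (simp add: power2_eq_square algebra_simps)
  define q where "q s = b * (1 + s\<^sup>2) + s * (1 + (cmod c)\<^sup>2)" for s :: real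
  have q1: "q (-1) < 0" "0 < q 1" using b sq by (auto simp: q_def)
  have "continuous_on {-1..1} q"
    unfolding q_def by (intro continuous_intros)
  then obtain s where s': "-1 \<le> s" "s \<le> 1" "q s = 0"
    using IVT'[of q "-1" 0 1] q1 by auto
  then have s: "-1 < s" "s < 1" using q1 by (auto simp: order_less_le)
  define A where "A = 1 + cnj c * s"
  define B where "B = c + s"
  have s2: "s\<^sup>2 < 1" using s by (simp add: abs_square_less_1)
  have ss0: "s * s0 < 1"
  proof -
    have "s * s0 \<le> 1 * s0" using s s0 by (intro mult_right_mono) auto
    then show ?thesis using s0 by simp
  qed
  have "(cmod A)\<^sup>2 - (cmod B)\<^sup>2 = (1 - (cmod c)\<^sup>2) * (1 - s\<^sup>2)"
    unfolding cmod_power2 A_def B_def by (simp add: power2_eq_square algebra_simps)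
  moreover have "0 < (1 - (cmod c)\<^sup>2) * (1 - s\<^sup>2)"
    using c s2 by (simp add: abs_square_less_1)
  ultimately have "(cmod B)\<^sup>2 < (cmod A)\<^sup>2" by linarith
  then have BA: "cmod B < cmod A"
    by (rule power2_less_imp_less) simp
  then have Anz: "A \<noteq> 0" by auto
  define a where "a = v * B / A"
  define u where "u = v * cnj A / A"
  have a: "cmod a < 1" using BA v Anz by (simp add: a_def norm_divide norm_mult)
  have u: "cmod u = 1" using v Anz by (simp add: u_def norm_divide norm_mult)
  have "cnj a * u = (cnj v * v) * cnj B / A"
    using Anz by (simp add: a_def u_def)
  then have au: "cnj a * u = cnj B / A" unfolding vv by simp
  have geo: "geodesic a u x = v * (cnj A * x + B) / (A + cnj B * x)" for x
  proof -
    have "u * x + a = v * (cnj A * x + B) / A" "1 + cnj a * u * x = (A + cnj B * x) / A"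
      unfolding au using Anz by (simp_all add: u_def a_def field_simps)
    then show ?thesis using Anz by (simp add: geodesic_def)
  qed
  have "Re (cnj B * cnj A) = q s"
    unfolding q_def b_def A_def B_def cmod_power2 by (simp add: power2_eq_square algebra_simps)
  moreover have "cnj B / A = cnj B * cnj A / complex_of_real ((cmod A)\<^sup>2)"
    unfolding complex_norm_square using Anz by simp
  ultimately have Re: "Re (cnj a * u) = 0"
    unfolding au using s'(3) by (simp only: Re_divide_of_real div_0)
  have "1 - (complex_of_real s)\<^sup>2 = complex_of_real (1 - s\<^sup>2)" by simp
  then have s2nz: "1 - (complex_of_real s)\<^sup>2 \<noteq> 0"
    using s2 by (metis less_irrefl of_real_eq_0_iff right_minus_eq)
  have g1: "geodesic a u (complex_of_real (- s)) = z1"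
  proof -
    have "cnj A * complex_of_real (- s) + B = c * (1 - s\<^sup>2)"
      "A + cnj B * complex_of_real (- s) = 1 - s\<^sup>2"
      unfolding A_def B_def by (simp_all add: algebra_simps power2_eq_square)
    then show ?thesis unfolding geo z1 using s2nz by simp
  qed
  define x2 where "x2 = (s0 - s) / (1 - s * s0)"
  have g2: "geodesic a u (complex_of_real x2) = z2"
  proof -
    define D where "D = complex_of_real (1 - s * s0)"
    have D: "D \<noteq> 0" using ss0 unfolding D_def of_real_eq_0_iff by simp
    have x2: "complex_of_real x2 = (s0 - s) / D" by (simp add: x2_def D_def)
    have "(cnj A * complex_of_real x2 + B) * D = (s0 + c) * (1 - s\<^sup>2)"
    proof -
      have "(cnj A * complex_of_real x2 + B) * D = cnj A * (s0 - s) + B * D"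
        using D by (simp add: x2 field_simps)
      also have "\<dots> = (s0 + c) * (1 - s\<^sup>2)"
        by (simp add: A_def B_def D_def power2_eq_square algebra_simps)
      finally show ?thesis .
    qed
    moreover have "(A + cnj B * complex_of_real x2) * D = (1 + cnj c * s0) * (1 - s\<^sup>2)"
    proof -
      have "(A + cnj B * complex_of_real x2) * D = A * D + cnj B * (s0 - s)"
        using D by (simp add: x2 field_simps)
      also have "\<dots> = (1 + cnj c * s0) * (1 - s\<^sup>2)"
        by (simp add: A_def B_def D_def power2_eq_square algebra_simps)
      finally show ?thesis .
    qed
    moreover have "geodesic a u (complex_of_real x2)
        = v * ((cnj A * complex_of_real x2 + B) * D) / ((A + cnj B * complex_of_real x2) * D)"
      unfolding geo using D by (simp add: mult.assoc[symmetric])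
    ultimately show ?thesis unfolding z2 using s2nz by (simp add: mult.assoc[symmetric])
  qed
  have "x2 \<in> {-1<..<1}"
  proof -
    have "0 < (1 - s) * (1 + s0)" "0 < (1 + s) * (1 - s0)" using s s0 by auto
    then show ?thesis using ss0 by (auto simp: x2_def field_simps)
  qed
  then show thesis
    using that[of a u "- s" x2] a u Re s g1 g2 by auto
qed

text \<open>Because \<open>a\<close> is nearest to the origin, the parametrization does not decrease the modulus of real
  points.  By the Schwarz--Pick equality \<open>1 - |T|\<^sup>2 = |T'| (1 - x\<^sup>2)\<close>, the condition that
  \<open>(1 - x\<^sup>2)\<^sup>2 p x\<close> be non-increasing then gives \<open>|T' x|\<^sup>2 p |T x| \<le> p x\<close>.\<close>

lemma geodesic_properties:
  fixes x :: real and \<tau> e :: "complex \<Rightarrow> complex"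
  assumes a: "cmod a < 1" and u: "cmod u = 1" and Re: "Re (cnj a * u) = 0" and x: "x \<in> {-1<..<1}"
  defines "\<tau> \<equiv> \<lambda>x :: complex. u * (1 - a * cnj a) / (1 + cnj a * u * x)\<^sup>2"
    and "e \<equiv> \<lambda>x :: complex. - (cnj a * u) / (1 + cnj a * u * x)"
  shows "cmod (geodesic a u x) < 1" "\<bar>x\<bar> \<le> cmod (geodesic a u x)"
    and "1 - (cmod (geodesic a u x))\<^sup>2 = cmod (\<tau> x) * (1 - x\<^sup>2)"
    and "\<tau> x \<noteq> 0"
    and "(geodesic a u has_field_derivative \<tau> x) (at x)"
    and "(\<tau> has_field_derivative 2 * e x * \<tau> x) (at x)"
    and "(e has_field_derivative (e x)\<^sup>2) (at x)"
proof -
  define d where "d = cnj a * u"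
  define r where "r = (cmod a)\<^sup>2"
  have r: "0 \<le> r" "r < 1" using a by (auto simp: r_def abs_square_less_1)
  have x2: "0 \<le> x\<^sup>2" "x\<^sup>2 < 1" using x by (auto simp: abs_square_less_1)
  have d: "(cmod d)\<^sup>2 = r" "Re d = 0"
    using u Re by (auto simp: d_def r_def norm_mult)
  have den: "(cmod (1 + d * x))\<^sup>2 = 1 + r * x\<^sup>2"
    using d by (simp add: cmod_power2 power_mult_distrib)
  have num: "(cmod (u * x + a))\<^sup>2 = x\<^sup>2 + r"
  proof -
    have "Re (cnj a * u) = Re a * Re u + Im a * Im u" by simp
    then have "2 * x * (Re a * Re u + Im a * Im u) = 0" using Re by simp
    moreover have "x\<^sup>2 * ((Re u)\<^sup>2 + (Im u)\<^sup>2) = x\<^sup>2"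
      using u by (simp flip: cmod_power2)
    ultimately show ?thesis
      unfolding r_def cmod_power2 by (simp add: power2_eq_square algebra_simps)
  qed
  have pos: "0 < 1 + r * x\<^sup>2" using r x2 by (simp add: add_pos_nonneg)
  have nz: "1 + d * x \<noteq> 0" using den pos by force
  have T2: "(cmod (geodesic a u x))\<^sup>2 = (x\<^sup>2 + r) / (1 + r * x\<^sup>2)"
    by (simp add: geodesic_def norm_divide power_divide num den[unfolded d_def])
  have "0 < (1 - r) * (1 - x\<^sup>2)" using r x2 by simp
  then have "(cmod (geodesic a u x))\<^sup>2 < 1"
    unfolding T2 using pos by (simp add: field_simps)
  then show "cmod (geodesic a u x) < 1" by (simp add: abs_square_less_1)
  have "x\<^sup>2 * x\<^sup>2 \<le> 1" using mult_mono[of "x\<^sup>2" 1 "x\<^sup>2" 1] x2 by simp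
  then have "r * (x\<^sup>2 * x\<^sup>2) \<le> r * 1" using r(1) by (rule mult_left_mono)
  then have "x\<^sup>2 \<le> (cmod (geodesic a u x))\<^sup>2"
    unfolding T2 using pos by (simp add: field_simps)
  then show "\<bar>x\<bar> \<le> cmod (geodesic a u x)"
    using abs_le_square_iff[of x "cmod (geodesic a u x)"] by simp
  have "1 - a * cnj a = complex_of_real (1 - r)"
    unfolding r_def of_real_diff complex_norm_square by simp
  then have t: "cmod (\<tau> x) = (1 - r) / (1 + r * x\<^sup>2)"
    using u r by (simp add: \<tau>_def norm_divide norm_mult norm_power den[unfolded d_def] del: of_real_diff)
  show "1 - (cmod (geodesic a u x))\<^sup>2 = cmod (\<tau> x) * (1 - x\<^sup>2)"
    unfolding T2 t using pos by (simp add: field_simps)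
  show "\<tau> x \<noteq> 0"
    using t r pos by (metis divide_eq_0_iff less_irrefl norm_zero right_minus_eq)
  have nz': "1 + cnj a * u * x \<noteq> 0" using nz by (simp add: d_def)
  show "(geodesic a u has_field_derivative \<tau> x) (at x)"
    unfolding geodesic_def[abs_def] \<tau>_def using nz'
    by (auto intro!: derivative_eq_intros simp: power2_eq_square) (simp add: algebra_simps)
  show "(\<tau> has_field_derivative 2 * e x * \<tau> x) (at x)"
    unfolding e_def \<tau>_def using nz'
    by (auto intro!: derivative_eq_intros) (simp add: divide_simps power2_eq_square power4_eq_xxxx)
  show "(e has_field_derivative (e x)\<^sup>2) (at x)"
    unfolding e_def using nz'
    by (auto intro!: derivative_eq_intros simp: power2_eq_square)
qed

section \<open>The injectivity criterion\<close>

theorem theorem1: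
  fixes p :: "real \<Rightarrow> real" and \<phi> :: "complex \<Rightarrow> complex ^ 'n"
  assumes "nehari_function p"
    and "holomorphic_curve_on \<phi> (ball 0 1)"
    and "\<And>z. z \<in> ball 0 1 \<Longrightarrow> curve_deriv \<phi> z \<noteq> 0"
    and "\<And>z. z \<in> ball 0 1 \<Longrightarrow>
           cmod (schwarzian \<phi> z) + 3/4 * (norm (curve_deriv \<phi> z))\<^sup>2 * \<bar>gauss_curvature \<phi> z\<bar>
             \<le> 2 * p (cmod z)"
  shows "inj_on \<phi> (ball 0 1)"
proof (rule inj_onI, rule ccontr)
  fix z1 z2 assume z: "z1 \<in> ball 0 1" "z2 \<in> ball 0 1" "\<phi> z1 = \<phi> z2" "z1 \<noteq> z2"
  obtain a u and x1 x2 :: real where au: "cmod a < 1" "cmod u = 1" "Re (cnj a * u) = 0"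
    and x: "x1 \<in> {-1<..<1}" "x2 \<in> {-1<..<1}" and zx: "geodesic a u x1 = z1" "geodesic a u x2 = z2"
    using geodesic_through[OF z(1,2,4)] by blast
  define T where "T t = geodesic a u (complex_of_real t)" for t
  define \<tau> where "\<tau> t = u * (1 - a * cnj a) / (1 + cnj a * u * complex_of_real t)\<^sup>2" for t
  define e where "e t = - (cnj a * u) / (1 + cnj a * u * complex_of_real t)" for t
  note geo = geodesic_properties[OF au]
  have dT: "(T has_vector_derivative \<tau> t) (at t)"
    and d\<tau>: "(\<tau> has_vector_derivative 2 * e t * \<tau> t) (at t)"
    and de: "(e has_vector_derivative (e t)\<^sup>2) (at t)" if "t \<in> {-1<..<1}" for t
    using geo(5-7)[OF that, THEN has_vector_derivative_real_field]
    unfolding T_def[abs_def] \<tau>_def[abs_def] e_def[abs_def] by simp_all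
  have Tball: "T t \<in> ball 0 1" if "t \<in> {-1<..<1}" for t
    using geo(1)[OF that] by (simp add: T_def)
  define D1 where "D1 = curve_deriv \<phi>"
  define D2 where "D2 = curve_deriv D1"
  define D3 where "D3 = curve_deriv D2"
  have hol: "holomorphic_curve_on \<phi> (ball 0 1)" "holomorphic_curve_on D1 (ball 0 1)"
    "holomorphic_curve_on D2 (ball 0 1)"
    using holomorphic_curve_derivD(1) assms(2) unfolding D1_def D2_def by (metis open_ball)+
  have dD: "((\<lambda>w. \<phi> w $ i) has_field_derivative D1 w $ i) (at w)"
    "((\<lambda>w. D1 w $ i) has_field_derivative D2 w $ i) (at w)"
    "((\<lambda>w. D2 w $ i) has_field_derivative D3 w $ i) (at w)" if "w \<in> ball 0 1" for w i
    using hol[THEN holomorphic_curve_derivD(2), OF open_ball that]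
    by (simp_all add: D1_def D2_def D3_def)
  define \<gamma> where "\<gamma> t = \<phi> (T t)" for t
  define \<gamma>1 where "\<gamma>1 t = \<tau> t *s D1 (T t)" for t
  define \<gamma>2 where "\<gamma>2 t = (\<tau> t)\<^sup>2 *s D2 (T t) + (2 * e t * \<tau> t) *s D1 (T t)" for t
  define \<gamma>3 where "\<gamma>3 t = (\<tau> t) ^ 3 *s D3 (T t) + (6 * e t * (\<tau> t)\<^sup>2) *s D2 (T t)
      + (6 * (e t)\<^sup>2 * \<tau> t) *s D1 (T t)" for t
  have "inj_on \<gamma> {-1<..<1}"
  proof (rule inj_on_if_ahlfors_schwarzian_le[OF assms(1)])
    fix t :: real assume t: "t \<in> {-1<..<1}"
    note dDt = dD[OF Tball[OF t]]
    have nz: "D1 (T t) \<noteq> 0" using assms(3)[OF Tball[OF t]] by (simp add: D1_def)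
    have \<tau>nz: "\<tau> t \<noteq> 0" using geo(4)[OF t] by (simp add: \<tau>_def)
    show "(\<gamma> has_vector_derivative \<gamma>1 t) (at t)"
      using has_vector_derivative_scaled_curve[OF dT[OF t] has_vector_derivative_const dDt(1), of 1]
      by (simp add: \<gamma>_def[abs_def] \<gamma>1_def)
    show "(\<gamma>1 has_vector_derivative \<gamma>2 t) (at t)"
      using has_vector_derivative_scaled_curve[OF dT[OF t] d\<tau>[OF t] dDt(2)]
      by (simp add: \<gamma>1_def[abs_def] \<gamma>2_def power2_eq_square add.commute)
    have s1: "((\<lambda>t. (\<tau> t)\<^sup>2) has_vector_derivative 4 * e t * (\<tau> t)\<^sup>2) (at t)"
      using has_vector_derivative_mult[OF d\<tau>[OF t] d\<tau>[OF t]]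
      by (simp add: power2_eq_square algebra_simps)
    have s2: "((\<lambda>t. 2 * e t * \<tau> t) has_vector_derivative 6 * (e t)\<^sup>2 * \<tau> t) (at t)"
      using has_vector_derivative_mult[OF has_vector_derivative_mult[OF has_vector_derivative_const[of 2] de[OF t]] d\<tau>[OF t]]
      by (simp add: power2_eq_square algebra_simps)
    have "((\<lambda>t. (\<tau> t)\<^sup>2 *s D2 (T t) + (2 * e t * \<tau> t) *s D1 (T t)) has_vector_derivative
        (4 * e t * (\<tau> t)\<^sup>2) *s D2 (T t) + ((\<tau> t)\<^sup>2 * \<tau> t) *s D3 (T t)
        + ((6 * (e t)\<^sup>2 * \<tau> t) *s D1 (T t) + (2 * e t * \<tau> t * \<tau> t) *s D2 (T t))) (at t)"
      by (intro has_vector_derivative_add has_vector_derivative_scaled_curve dT[OF t] s1 s2 dDt)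
    moreover have "(4 * e t * (\<tau> t)\<^sup>2) *s D2 (T t) + ((\<tau> t)\<^sup>2 * \<tau> t) *s D3 (T t)
        + ((6 * (e t)\<^sup>2 * \<tau> t) *s D1 (T t) + (2 * e t * \<tau> t * \<tau> t) *s D2 (T t)) = \<gamma>3 t"
      by (simp add: \<gamma>3_def vec_eq_iff algebra_simps power2_eq_square power3_eq_cube)
    ultimately show "(\<gamma>2 has_vector_derivative \<gamma>3 t) (at t)"
      by (simp add: \<gamma>2_def[abs_def])
    show \<gamma>1nz: "\<gamma>1 t \<noteq> 0"
      using nz \<tau>nz by (simp add: \<gamma>1_def)
    let ?S = "vec_schwarzian (D1 (T t)) (D2 (T t)) (D3 (T t))"
    let ?K = "vec_curvature (D1 (T t)) (D2 (T t))"
    have SK: "cmod ?S + 3/2 * \<bar>?K\<bar> \<le> 2 * p (cmod (T t))"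
      using assms(4)[OF Tball[OF t]]
        schwarzian_eq_vec_schwarzian[OF assms(2) open_ball assms(3) Tball[OF t]]
        speed_curvature_eq[OF assms(2) open_ball assms(3) Tball[OF t]]
      by (simp add: D1_def D2_def D3_def)
    have "ahlfors_schwarzian (\<gamma>1 t) (\<gamma>2 t) (\<gamma>3 t) = Re ((\<tau> t)\<^sup>2 * ?S) + 3/2 * ((cmod (\<tau> t))\<^sup>2 * ?K)"
      unfolding ahlfors_schwarzian_eq_vec_schwarzian[OF \<gamma>1nz]
      unfolding \<gamma>1_def \<gamma>2_def \<gamma>3_def
        vec_schwarzian_reparametrize[OF nz \<tau>nz] vec_curvature_reparametrize[OF nz \<tau>nz] ..
    also have "\<dots> \<le> (cmod (\<tau> t))\<^sup>2 * cmod ?S + 3/2 * ((cmod (\<tau> t))\<^sup>2 * \<bar>?K\<bar>)"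
      using complex_Re_le_cmod[of "(\<tau> t)\<^sup>2 * ?S"]
      by (intro add_mono mult_left_mono) (simp_all add: norm_mult norm_power)
    also have "\<dots> = (cmod (\<tau> t))\<^sup>2 * (cmod ?S + 3/2 * \<bar>?K\<bar>)"
      by (simp add: algebra_simps)
    also have "\<dots> \<le> (cmod (\<tau> t))\<^sup>2 * (2 * p (cmod (T t)))"
      by (rule mult_left_mono[OF SK]) simp
    also have "\<dots> \<le> 2 * p t"
    proof -
      have T: "cmod (T t) < 1" "\<bar>t\<bar> \<le> cmod (T t)" "1 - (cmod (T t))\<^sup>2 = cmod (\<tau> t) * (1 - t\<^sup>2)"
        using geo(1-3)[OF t] by (simp_all add: T_def \<tau>_def)
      have anti: "antimono_on {0..<1} (\<lambda>x. (1 - x\<^sup>2)\<^sup>2 * p x)" and even: "p (- t) = p t"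
        using assms(1) t by (auto simp: nehari_function_def)
      have "(1 - (cmod (T t))\<^sup>2)\<^sup>2 * p (cmod (T t)) \<le> (1 - \<bar>t\<bar>\<^sup>2)\<^sup>2 * p \<bar>t\<bar>"
        using monotone_onD[OF anti, of "\<bar>t\<bar>" "cmod (T t)"] T t by auto
      moreover have "p \<bar>t\<bar> = p t" using even by (simp add: abs_if)
      ultimately have "(1 - t\<^sup>2)\<^sup>2 * ((cmod (\<tau> t))\<^sup>2 * p (cmod (T t))) \<le> (1 - t\<^sup>2)\<^sup>2 * p t"
        unfolding T(3) by (simp add: power_mult_distrib mult_ac)
      moreover have "0 < (1 - t\<^sup>2)\<^sup>2"
        using t by (intro zero_less_power) (simp add: abs_square_less_1 abs_less_iff)
      ultimately show ?thesis by simp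
    qed
    finally show "ahlfors_schwarzian (\<gamma>1 t) (\<gamma>2 t) (\<gamma>3 t) \<le> 2 * p t" .
  qed
  moreover have "\<gamma> x1 = \<gamma> x2" using zx z by (simp add: \<gamma>_def T_def)
  ultimately have "x1 = x2" using x by (auto dest: inj_onD)
  with zx z show False by simp
qed

end
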